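(* Consider the online assortment problem with inventory shocks, the Batched Inventory Balancing (BIB) algorithm, and the worst-case competitive ratio $\mathrm{CR}_{\mathcal A}(c_0)$ as a function of the smallest initial inventory $c_0$, all defined in the context. Let $\Psi(x)=\frac{e^{1-x}-e}{1-e}$ for $x\in[0,1]$, and for each positive integer $c_0$ let $\gamma(c_0)\in[1,c_0]$ be an integer with $\gamma(c_0)=\Theta(\sqrt{c_0})$ as $c_0\to\infty$. Write $\mathrm{BIB}(\Psi,\gamma)$ for the BIB algorithm with penalty function $\Psi$ and batch-size threshold $\gamma$. Then: (a) The competitive ratio of BIB with these parameters approaches $1-\frac1e$: $\ \mathrm{CR}_{\mathrm{BIB}(\Psi,\gamma(c_0))}(c_0)\to 1-\frac1e$ as $c_0\to\infty$. (b) These parameters asymptotically optimize the competitive ratio of BIB: for any choice, for each $c_0$, of a monotone non-decreasing, concave, differentiable penalty function $\Psi'_{c_0}:[0,1]\to[0,1]$ with $\Psi'_{c_0}(0)=0$, $\Psi'_{c_0}(1)=1$ and of an integer threshold $\gamma'(c_0)\in[1,c_0]$, we have $\limsup_{c_0\to\infty}\mathrm{CR}_{\mathrm{BIB}(\Psi'_{c_0},\gamma'(c_0))}(c_0)\le 1-\frac1e$. (c) The bound $1-\frac1e$ is asymptotically optimal among all online algorithms, even in the special cases without inventory shocks: for every online algorithm $\mathcal A$, $\limsup_{c_0\to\infty}\mathrm{CR}^{0}_{\mathcal A}(c_0)\le 1-\frac1e$, where $\mathrm{CR}^{0}_{\mathcal A}(c_0)$ is defined as $\mathrm{CR}_{\mathcal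 A}(c_0)$ but with the infimum restricted to either of the following classes of instances: (i) online assortment without inventory shocks, i.e. $d_i=\infty$ for all $i$ (sold units never return) and $\xi_{i,t}=0$ for all $i,t$; (ii) online vertex-weighted $b$-matching without inventory shocks, i.e. the instances in (i) in which only single products (or nothing) can be offered and each consumer $t$ has a set $N_t\subseteq[n]$ of acceptable products with $\phi_t(\{i\},i)=1$ if $i\in N_t$ and $\phi_t(\{i\},i)=0$ otherwise.
   Context: **Model.** There are $n$ products, indexed by $[n]=\{1,\dots,n\}$. Product $i$ has initial inventory $c_i\in\mathbb{Z}_{+}$ (positive integer), a deterministic usage duration $d_i$ (positive integer or $\infty$) and per-unit price $r_i\ge 0$. Time is discrete, $t\in[T]$. - Exogenous shocks: at the beginning of period $t$, $\xi_{i,t}\in\mathbb{Z}_{\ge0}$ new units of each product $i$ are added to the inventory (in addition to the initial inventory). - Consumers: consumer $t$ arrives at period $t$ with a choice model $\phi_t:\mathcal{S}\times[n]\to[0,1]$, where $\mathcal{S}\subseteq 2^{[n]}$ is the (nonempty) collection of feasible assortments; $\phi_t(S,i)$ is the probability that consumer $t$ chooses product $i$ when offered $S$ (so $\phi_t(S,i)=0$ for $i\notin S$ and $\sum_i\phi_t(S,i)\le1$; with the remaining probability she chooses nothing). - At period $t$, $\phi_t$ and $\{\xi_{i,t}\}_{i}$ are revealed; the platform, knowing the history, offers an assortment $S_t\in\mathcal{S}$ of products with available inventory. Consumer $t$ randomly (independently given the history) chooses a product $i_t\in S_t$ according to $\phi_t(S_t,\cdot)$, or nothing. If $i_t=i$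 is chosen, revenue $r_i$ is collected, and one unit of $i$ leaves the inventory. - Endogenous shocks: a unit of product $i$ sold at period $t$ returns to the inventory at the beginning of period $t+d_i$. **Standing assumptions.** (1) Weak substitutability: $\phi_t(\emptyset,i)=0$, and $\phi_t(S,i)\ge\phi_t(S\cup\{j\},i)$ for all $t$, $i$, $j\neq i$ and $S\in\mathcal{S}$ (whenever $S\cup\{j\}\in\mathcal S$). (2) $\mathcal{S}$ is downward closed: $S\in\mathcal{S}$, $S'\subseteq S$ imply $S'\in\mathcal{S}$. (3) There is an exact oracle that, for any $t$ and any $\hat R\in\mathbb{R}_{+}^n$, returns an assortment in $\arg\max_{S\in\mathcal{S}}\sum_{i}\hat R_i\phi_t(S,i)$ having smallest cardinality among all maximizers. **Benchmark and competitive ratio.** The clairvoyant optimum offline benchmark is the maximum expected revenue over all (possibly adaptive) inventory-feasible policies that know the entire sequence $\{\phi_t,\xi_{i,t}\}_{i\in[n],t\in[T]}$ in advance, but not the realizations of the consumers' random choices. Denote it $\mathrm{OPT}[\{\phi_t,\xi_{i,t}\}]$. For fixed products $\{r_i,d_i,c_i\}_{i\in[n]}$, the competitive ratio of an online algorithm $\mathcal A$ is $\inf_{T\ge1}\inf_{\{\phi_t,\xi_{i,t}\}}\mathrm{Rev}_{\mathcal A}[\{\phi_t,\xi_{i,t}\}]/\mathrm{OPT}[\{\phi_t,\xi_{i,t}\}]$ (over sequences with $\mathrm{OPT}>0$), where $\mathrm{Rev}_{\mathcal A}$ is the expected total revenue of $\mathcal A$. An online algorithm (possibly randomized) knows the product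 parameters and at period $t$ only what has been revealed up to period $t$. For a positive integer $c_0$, $\mathrm{CR}_{\mathcal A}(c_0)$ denotes the infimum of the competitive ratio of $\mathcal A$ over all $n$, all $\mathcal S$, and all products $\{r_i,d_i,c_i\}_{i\in[n]}$ with $\min_{i\in[n]}c_i=c_0$. **BIB algorithm** (parameters: penalty function $\Psi:[0,1]\to[0,1]$ with $\Psi(0)=0,\Psi(1)=1$, and threshold $\gamma\in\mathbb{N}$). For each product $i$, every unit is permanently assigned to one batch $B_{i,j}$, $j=1,2,\dots$. Initially $B_{i,1}$ consists of the $c_i$ initial units and is "ready", $B_{i,2}=\emptyset$ is "charging", and $h_i=1$ (number of ready batches). In each period $t$: 1. For each $i$, each new unit of product $i$ added by the exogenous shock is put one at a time into the charging batch $B_{i,h_i+1}$; as soon as $|B_{i,h_i+1}|=\gamma$, that batch becomes ready, $h_i$ is increased by 1, and a new empty charging batch $B_{i,h_i+1}$ is created. Sold units that return rejoin the batch to which they were originally assigned. 2. For each ready batch $B_{i,j}$ ($j\in[h_i]$), let the normalized inventory level $f_{i,j,t}$ be the fraction of the $|B_{i,j}|$ units of $B_{i,j}$ currently available, i.e. $f_{i,j,t}=1-\frac{1}{|B_{i,j}|}\cdot\#\{t'\in[T]: t-d_i+1\le t'\le t-1,\text{ a unit of }B_{i,j}\text{ was sold at }t'\}$. 3. Using the oracle with $\hat R_i=r_i\Psi(\max_{j\in[h_i]}f_{i,j,t})$, compute and offer $S_t\in\arg\max_{S\in\mathcal{S}}\sum_{i\in S}r_i\Psi(\max_{j\in[h_i]}f_{i,j,t})\phi_t(S,i)$.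 4. If consumer $t$ chooses product $i^*$, allocate an available unit from batch $B_{i^*,j^*}$ with $j^*\in\arg\max_{j\in[h_{i^*}]}f_{i^*,j,t}$. *)

theory Defs
  imports "HOL-Probability.Probability" "HOL-Library.Landau_Symbols" "HOL-Library.Extended_Nat"
begin

section \<open>Instances\<close>

record products =
  num :: nat
  assorts :: "nat set set"
  init :: "nat \<Rightarrow> nat"
  dur :: "nat \<Rightarrow> enat"
  price :: "nat \<Rightarrow> real"

definition items :: "products \<Rightarrow> nat set" where
  "items P = {1..num P}"

definition valid_products :: "products \<Rightarrow> bool" where
  "valid_products P \<longleftrightarrow>
     1 \<le> num P \<and>
     assorts P \<subseteq> Pow (items P) \<and> assorts P \<noteq> {} \<and>
     (\<forall>S\<in>assorts P. \<forall>S'. S' \<subseteq> S \<longrightarrow> S' \<in> assorts P) \<and>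
     (\<forall>i\<in>items P. 0 < init P i \<and> 0 < dur P i \<and> 0 \<le> price P i)"

definition min_init :: "products \<Rightarrow> nat" where
  "min_init P = Min (init P ` items P)"

text \<open>A choice model \<open>\<phi>\<close> gives the probability \<open>\<phi> S i\<close> that product \<open>i\<close> is chosen from assortment
  \<open>S\<close>; only its values on feasible assortments matter.\<close>

type_synonym choice = "nat set \<Rightarrow> nat \<Rightarrow> real"

definition weakly_substitutable :: "products \<Rightarrow> choice \<Rightarrow> bool" where
  "weakly_substitutable P \<phi> \<longleftrightarrow>
     (\<forall>i\<in>items P. \<phi> {} i = 0) \<and>
     (\<forall>i\<in>items P. \<forall>j\<in>items P. \<forall>S\<in>assorts P.
        j \<noteq> i \<and> insert j S \<in> assorts P \<longrightarrow> \<phi> (insert j S) i \<le> \<phi> S i)"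

definition valid_choice :: "products \<Rightarrow> choice \<Rightarrow> bool" where
  "valid_choice P \<phi> \<longleftrightarrow>
     (\<forall>S\<in>assorts P. (\<forall>i. 0 \<le> \<phi> S i \<and> \<phi> S i \<le> 1) \<and> (\<forall>i. i \<notin> S \<longrightarrow> \<phi> S i = 0) \<and>
        (\<Sum>i\<in>items P. \<phi> S i) \<le> 1) \<and>
     weakly_substitutable P \<phi>"

text \<open>A period consists of the choice model of its consumer and the exogenous shock \<open>\<xi> i\<close> to each
  product \<open>i\<close>. A list of periods is an input sequence, its length being the horizon; element \<open>k\<close> of
  the list (counting from 0) is period \<open>k + 1\<close>.\<close>

type_synonym period = "choice \<times> (nat \<Rightarrow> nat)"

definition valid_arrivals :: "products \<Rightarrow> period list \<Rightarrow> bool" where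
  "valid_arrivals P arr \<longleftrightarrow> (\<forall>(\<phi>, \<xi>) \<in> set arr. valid_choice P \<phi>)"


section \<open>Policies, revenue and the clairvoyant benchmark\<close>

text \<open>A history lists, in chronological order, the offered assortment and the choice made
  (\<open>None\<close> if nothing was chosen) for every past period.\<close>

type_synonym history = "(nat set \<times> nat option) list"

text \<open>Randomized policies are behavioural: the offered assortment is drawn afresh from a distribution
  depending on the history. As the history records the policy's own past offers, this covers
  policies with an internal random seed.\<close>

type_synonym policy = "history \<Rightarrow> nat set pmf"

text \<open>\<open>L\<close> lists what (if anything) was sold in each past period, so that the current period is
  \<open>length L\<close> when counting from 0. A sale in period \<open>k\<close> is back in period \<open>k + d\<close>.\<close>

definition in_use :: "enat \<Rightarrow> 'a option list \<Rightarrow> 'a \<Rightarrow> nat" where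
  "in_use d L x =
     card {k. k < length L \<and> L ! k = Some x \<and> enat (length L) < enat k + d}"

definition in_stock :: "products \<Rightarrow> period list \<Rightarrow> history \<Rightarrow> nat \<Rightarrow> bool" where
  "in_stock P arr h i \<longleftrightarrow>
     in_use (dur P i) (map snd h) i
       < init P i + (\<Sum>(\<phi>, \<xi>) \<leftarrow> take (Suc (length h)) arr. \<xi> i)"

definition feasible_offers :: "products \<Rightarrow> period list \<Rightarrow> history \<Rightarrow> nat set set" where
  "feasible_offers P arr h = {S \<in> assorts P. \<forall>i\<in>S. in_stock P arr h i}"

definition choice_pmf :: "products \<Rightarrow> choice \<Rightarrow> nat set \<Rightarrow> nat option pmf" where
  "choice_pmf P \<phi> S =
     embed_pmf (\<lambda>x. case x of None \<Rightarrow> 1 - (\<Sum>i\<in>items P. \<phi> S i) | Some i \<Rightarrow> \<phi> S i)"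

primrec history_pmf :: "products \<Rightarrow> period list \<Rightarrow> policy \<Rightarrow> nat \<Rightarrow> history pmf" where
  "history_pmf P arr \<pi> 0 = return_pmf []"
| "history_pmf P arr \<pi> (Suc k) =
     do {
       h \<leftarrow> history_pmf P arr \<pi> k;
       S \<leftarrow> \<pi> h;
       c \<leftarrow> choice_pmf P (fst (arr ! k)) S;
       return_pmf (h @ [(S, c)])
     }"

definition feasible_policy :: "products \<Rightarrow> period list \<Rightarrow> policy \<Rightarrow> bool" where
  "feasible_policy P arr \<pi> \<longleftrightarrow>
     (\<forall>k < length arr. \<forall>h \<in> set_pmf (history_pmf P arr \<pi> k).
        set_pmf (\<pi> h) \<subseteq> feasible_offers P arr h)"

definition revenue :: "products \<Rightarrow> history \<Rightarrow> real" where
  "revenue P h = (\<Sum>(S, c) \<leftarrow> h. case c of None \<Rightarrow> 0 | Some i \<Rightarrow> price P i)"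

definition expected_revenue :: "products \<Rightarrow> period list \<Rightarrow> policy \<Rightarrow> real" where
  "expected_revenue P arr \<pi> =
     measure_pmf.expectation (history_pmf P arr \<pi> (length arr)) (revenue P)"

definition OPT :: "products \<Rightarrow> period list \<Rightarrow> real" where
  "OPT P arr = (SUP \<pi> \<in> {\<pi>. feasible_policy P arr \<pi>}. expected_revenue P arr \<pi>)"


section \<open>Online algorithms and competitive ratios\<close>

text \<open>An online algorithm sees the products, the periods revealed so far (including the current one)
  and the history.\<close>

type_synonym algorithm = "products \<Rightarrow> period list \<Rightarrow> history \<Rightarrow> nat set pmf"

definition run :: "algorithm \<Rightarrow> products \<Rightarrow> period list \<Rightarrow> policy" where
  "run A P arr h = A P (take (Suc (length h)) arr) h"

definition online_algorithm :: "algorithm \<Rightarrow> bool" where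
  "online_algorithm A \<longleftrightarrow>
     (\<forall>P arr. valid_products P \<and> valid_arrivals P arr \<longrightarrow> feasible_policy P arr (run A P arr))"

type_synonym instance_class = "products \<Rightarrow> period list \<Rightarrow> bool"

text \<open>Infima are taken in the extended reals, so that products without any input sequence of positive
  optimum (or outside the class) do not contribute.\<close>

definition competitive_ratio_on :: "instance_class \<Rightarrow> algorithm \<Rightarrow> products \<Rightarrow> ereal" where
  "competitive_ratio_on K A P =
     (INF arr \<in> {arr. 1 \<le> length arr \<and> valid_arrivals P arr \<and> K P arr \<and> 0 < OPT P arr}.
        ereal (expected_revenue P arr (run A P arr) / OPT P arr))"

definition CR_on :: "instance_class \<Rightarrow> algorithm \<Rightarrow> nat \<Rightarrow> ereal" where
  "CR_on K A c\<^sub>0 =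
     (INF P \<in> {P. valid_products P \<and> min_init P = c\<^sub>0}. competitive_ratio_on K A P)"

definition CR :: "algorithm \<Rightarrow> nat \<Rightarrow> ereal" where
  "CR = CR_on (\<lambda>P arr. True)"

definition no_shocks :: instance_class where
  "no_shocks P arr \<longleftrightarrow>
     (\<forall>i\<in>items P. dur P i = \<infinity>) \<and> (\<forall>(\<phi>, \<xi>) \<in> set arr. \<forall>i\<in>items P. \<xi> i = 0)"

definition vertex_weighted_b_matching :: instance_class where
  "vertex_weighted_b_matching P arr \<longleftrightarrow>
     no_shocks P arr \<and>
     assorts P = insert {} ((\<lambda>i. {i}) ` items P) \<and>
     (\<forall>(\<phi>, \<xi>) \<in> set arr. \<exists>N \<subseteq> items P. \<forall>i\<in>items P. \<phi> {i} i = (if i \<in> N then 1 else 0))"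


section \<open>Batched Inventory Balancing\<close>

text \<open>For each product, the state is the list of sizes of its ready batches together with the size of
  its charging batch. Batches are numbered from 0.\<close>

fun add_unit :: "nat \<Rightarrow> nat list \<times> nat \<Rightarrow> nat list \<times> nat" where
  "add_unit \<gamma> (bs, m) = (if Suc m = \<gamma> then (bs @ [Suc m], 0) else (bs, Suc m))"

definition ready_batches :: "nat \<Rightarrow> products \<Rightarrow> period list \<Rightarrow> nat \<Rightarrow> nat list" where
  "ready_batches \<gamma> P arr i = fst (fold (\<lambda>(\<phi>, \<xi>). add_unit \<gamma> ^^ \<xi> i) arr ([init P i], 0))"

text \<open>The log of BIB records the product and the batch of each sold unit; \<open>arr\<close> is the
  sequence of periods revealed so far, including the current one.\<close>

type_synonym batch_log = "(nat \<times> nat) option list"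

definition level :: "nat \<Rightarrow> products \<Rightarrow> period list \<Rightarrow> batch_log \<Rightarrow> nat \<Rightarrow> nat \<Rightarrow> real" where
  "level \<gamma> P arr L i j =
     1 - real (in_use (dur P i) L (i, j)) / real (ready_batches \<gamma> P arr i ! j)"

definition max_level :: "nat \<Rightarrow> products \<Rightarrow> period list \<Rightarrow> batch_log \<Rightarrow> nat \<Rightarrow> real" where
  "max_level \<gamma> P arr L i = Max (level \<gamma> P arr L i ` {..<length (ready_batches \<gamma> P arr i)})"

definition best_batches :: "nat \<Rightarrow> products \<Rightarrow> period list \<Rightarrow> batch_log \<Rightarrow> nat \<Rightarrow> nat set" where
  "best_batches \<gamma> P arr L i =
     {j. is_arg_max (level \<gamma> P arr L i) (\<lambda>j. j < length (ready_batches \<gamma> P arr i)) j}"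

text \<open>Ties are broken arbitrarily, both by the oracle and in the choice of the batch, but only on the
  basis of what has been revealed so far.\<close>

type_synonym oracle_fun = "products \<Rightarrow> period list \<Rightarrow> (nat \<Rightarrow> real) \<Rightarrow> nat set"

definition exact_oracle :: "oracle_fun \<Rightarrow> bool" where
  "exact_oracle orc \<longleftrightarrow>
     (\<forall>P arr R. valid_products P \<and> valid_arrivals P arr \<and> arr \<noteq> [] \<and> (\<forall>i\<in>items P. 0 \<le> R i) \<longrightarrow>
        is_arg_min card
          (is_arg_max (\<lambda>S. \<Sum>i\<in>items P. R i * fst (last arr) S i) (\<lambda>S. S \<in> assorts P))
          (orc P arr R))"

type_synonym batch_rule = "products \<Rightarrow> period list \<Rightarrow> history \<Rightarrow> nat \<Rightarrow> nat set \<Rightarrow> nat"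

definition valid_batch_rule :: "batch_rule \<Rightarrow> bool" where
  "valid_batch_rule br \<longleftrightarrow> (\<forall>P arr h i J. J \<noteq> {} \<longrightarrow> br P arr h i J \<in> J)"

primrec bib_log ::
  "nat \<Rightarrow> batch_rule \<Rightarrow> products \<Rightarrow> period list \<Rightarrow> history \<Rightarrow> nat \<Rightarrow> batch_log" where
  "bib_log \<gamma> br P arr h 0 = []"
| "bib_log \<gamma> br P arr h (Suc k) =
     (let L = bib_log \<gamma> br P arr h k; revealed = take (Suc k) arr in
      L @ [map_option
               (\<lambda>i. (i, br P revealed (take k h) i (best_batches \<gamma> P revealed L i)))
               (snd (h ! k))])"

definition BIB :: "oracle_fun \<Rightarrow> batch_rule \<Rightarrow> (real \<Rightarrow> real) \<Rightarrow> nat \<Rightarrow> algorithm" where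
  "BIB orc br \<Psi> \<gamma> P arr h =
     return_pmf (orc P arr
       (\<lambda>i. price P i * \<Psi> (max_level \<gamma> P arr (bib_log \<gamma> br P arr h (length h)) i)))"

definition exp_penalty :: "real \<Rightarrow> real" where
  "exp_penalty x = (exp (1 - x) - exp 1) / (1 - exp 1)"

definition admissible_penalty :: "(real \<Rightarrow> real) \<Rightarrow> bool" where
  "admissible_penalty \<Psi> \<longleftrightarrow>
     \<Psi> ` {0..1} \<subseteq> {0..1} \<and> \<Psi> 0 = 0 \<and> \<Psi> 1 = 1 \<and>
     mono_on {0..1} \<Psi> \<and> concave_on {0..1} \<Psi> \<and> \<Psi> differentiable_on {0..1}"

end

theory Submission
  imports Defs "HOL-Real_Asymp.Real_Asymp"
begin

text \<open>
  Multiplying the penalty \<open>exp_penalty\<close> by \<open>1 - 1/e\<close> gives \<open>g x = 1 - exp (- x)\<close>, and the oracle maximises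
  the same objective. Split the price of each unit sold at level \<open>f\<close> into the reward \<open>g f\<close> and the rest
  \<open>exp (- f)\<close>. As the offer maximises the expected reward, BIB earns in expectation at least the reward
  that the sales of an independent clairvoyant policy would earn at the levels of BIB. It remains to
  charge \<open>exp (- f) - 1/e\<close> for each clairvoyant sale to the rest kept by the sales of BIB, which is done
  path by path and batch by batch. With \<open>u\<close> the fraction of a batch of size \<open>b\<close> in use, \<open>exp u - 1\<close>
  is \<open>exp (1/b) - 1\<close> times a geometric sum over the sales still in use, and each of these is
  charged by at most the number of clairvoyant sales that fit into one usage period.

  For the upper bound, every product has capacity \<open>c\<close> and the consumers arrive in phases of \<open>c\<close>. After
  each phase an adversary, who knows the distribution of the algorithm, retires the product of
  least expected sales.
\<close>

section \<open>Loads of a single batch\<close>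

text \<open>The obstacle is that sold units may come back, so loads rise and fall and no potential
  in the number of past sales is available. The exponential gets around this: at load
  \<open>u\<close> the level is \<open>1 - u\<close>, so a clairvoyant sale has to be charged
  \<open>(exp u - 1) / e\<close>, while a sale of BIB at load \<open>u\<close> keeps exactly
  \<open>exp u / e\<close>. That \<open>exp u - 1\<close> is the integral of \<open>exp\<close> then
  balances the two, and its discrete form involves only the loads at which the units now in use were
  sold. Independence of the two runs means that the clairvoyant policy enters in just two ways:
  through its offer in a single period, which cannot beat that of BIB, and through the stock
  constraint along each of its paths. BIB never tests the stock. That it offers only what is
  available has to be derived from the tie-breaking of the oracle; after that, BIB with any
  admissible penalty is an online algorithm, and (b) is a case of the general upper bound. There the
  number of products tends to infinity for fixed \<open>c\<close>, so the bound
  \<open>1 - 1/e\<close> holds for each \<open>c \<ge> 1\<close> and not only in the limit.\<close>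

lemma sum_power_rank:
  fixes W :: "nat set" and x :: real
  assumes "finite W"
  shows "(\<Sum>a\<in>W. x ^ card {a'\<in>W. a' < a}) = (\<Sum>k<card W. x ^ k)"
  using assms
proof (induction rule: finite_linorder_max_induct)
  case (insert b W)
  have "b \<notin> W"
    using insert.hyps(2) by blast
  have "{a' \<in> insert b W. a' < a} = {a' \<in> W. a' < a}" if "a \<in> W" for a
    using insert.hyps(2) that by auto
  moreover have "{a' \<in> insert b W. a' < b} = W"
    using insert.hyps(2) by auto
  ultimately show ?case
    using insert.hyps(1) insert.IH \<open>b \<notin> W\<close> by simp
qed auto

text \<open>The window of \<open>in_use\<close>, for a set of sale times instead of a log, so that
  it serves both for the sales of BIB from one batch and for those of the clairvoyant.\<close>

definition active :: "enat \<Rightarrow> nat set \<Rightarrow> nat \<Rightarrow> nat set" where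
  "active d A t = {a \<in> A. a < t \<and> enat t < enat a + d}"

lemma finite_active [simp]: "finite A \<Longrightarrow> finite (active d A t)"
  by (simp add: active_def)

lemma active_inherit:
  assumes "a' \<in> active d A t" "a' < a" "a < t"
  shows "a' \<in> active d A a"
proof -
  have "enat a \<le> enat t" and "enat t < enat a' + d"
    using assms by (simp_all add: active_def)
  then have "enat a < enat a' + d"
    by (rule le_less_trans)
  then show ?thesis using assms by (simp add: active_def)
qed

text \<open>Both sides are geometric sums in \<open>exp (1 / b)\<close>: the element of rank \<open>k\<close> among the sales in use
  at time \<open>t\<close> was sold when at least \<open>k\<close> units were in use.\<close>

lemma exp_load_le:
  assumes "finite A" "0 < b"
  shows "exp (card (active d A t) / real b) - 1
           \<le> (exp (1 / b) - 1) * (\<Sum>a\<in>active d A t. exp (card (active d A a) / real b))"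
proof -
  define x where "x = exp (1 / real b)"
  have x: "1 < x" and pow: "exp (real k / real b) = x ^ k" for k :: nat
    using assms(2) by (simp_all add: x_def exp_of_nat_mult [symmetric])
  let ?W = "active d A t"
  have "x ^ card ?W - 1 = (x - 1) * (\<Sum>k<card ?W. x ^ k)"
    by (simp add: power_diff_1_eq)
  also have "(\<Sum>k<card ?W. x ^ k) = (\<Sum>a\<in>?W. x ^ card {a'\<in>?W. a' < a})"
    using assms(1) by (simp add: sum_power_rank)
  also have "\<dots> \<le> (\<Sum>a\<in>?W. x ^ card (active d A a))"
  proof (intro sum_mono power_increasing card_mono)
    fix a assume "a \<in> ?W"
    then have "a < t" by (simp add: active_def)
    then show "{a'\<in>?W. a' < a} \<subseteq> active d A a"
      using active_inherit by blast
  qed (use x assms(1) in auto)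
  finally show ?thesis
    using x by (simp add: pow x_def[symmetric])
qed

text \<open>Double counting. By \<open>exp_load_le\<close> each \<open>q\<close> is charged to the
  sales of \<open>A\<close> in use at \<open>q\<close>; after exchanging the sums, each
  \<open>a\<close> is charged by the elements of \<open>Q\<close> in its usage window, of which
  there are at most \<open>cap\<close>.\<close>

lemma single_batch_bound:
  assumes fin: "finite A" "finite Q" and "0 < b"
    and load: "\<And>q. q \<in> Q \<Longrightarrow> card (active d Q q) < cap"
  shows "(\<Sum>q\<in>Q. exp (card (active d A q) / real b) - 1)
           \<le> real cap * (exp (1 / b) - 1) * (\<Sum>a\<in>A. exp (card (active d A a) / real b))"
proof -
  let ?e = "\<lambda>t. exp (card (active d A t) / real b)"
  have count: "card {q\<in>Q. a < q \<and> enat q < enat a + d} \<le> cap" (is "card ?Qa \<le> _") for a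
  proof (cases "?Qa = {}")
    case False
    \<comment> \<open>All elements of the window are later than \<open>a\<close> and last equally
      long, so they are still in use at the last of them. The load there is below
      \<open>cap\<close>, and the last one adds one.\<close>
    define q where "q = Max ?Qa"
    have "q \<in> ?Qa"
      unfolding q_def using False fin by (intro Max_in) auto
    have "?Qa \<subseteq> insert q (active d Q q)"
    proof
      fix q' assume q': "q' \<in> ?Qa"
      then have "q' \<le> q" using fin by (simp add: q_def)
      moreover have "enat a + d \<le> enat q' + d"
        using q' by (intro add_right_mono) simp
      with \<open>q \<in> ?Qa\<close> have "enat q < enat q' + d"
        by (auto intro: less_le_trans)
      ultimately show "q' \<in> insert q (active d Q q)"
        using q' by (auto simp: active_def)
    qed
    then have "card ?Qa \<le> card (insert q (active d Q q))"
      using fin by (intro card_mono) auto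
    also have "\<dots> \<le> Suc (card (active d Q q))"
      by (rule card_insert_le_m1) auto
    also have "\<dots> \<le> cap" using load \<open>q \<in> ?Qa\<close> by (simp add: Suc_le_eq)
    finally show ?thesis .
  qed (simp only: card.empty)
  have "(\<Sum>q\<in>Q. ?e q - 1) \<le> (\<Sum>q\<in>Q. (exp (1 / b) - 1) * (\<Sum>a\<in>active d A q. ?e a))"
    using exp_load_le[OF fin(1) \<open>0 < b\<close>] by (intro sum_mono) simp
  also have "\<dots> = (exp (1 / b) - 1) * (\<Sum>q\<in>Q. \<Sum>a | a \<in> A \<and> a < q \<and> enat q < enat a + d. ?e a)"
    by (simp add: sum_distrib_left active_def)
  also have "(\<Sum>q\<in>Q. \<Sum>a | a \<in> A \<and> a < q \<and> enat q < enat a + d. ?e a)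
      = (\<Sum>a\<in>A. \<Sum>q | q \<in> Q \<and> a < q \<and> enat q < enat a + d. ?e a)"
    using fin by (rule sum.swap_restrict[rotated])
  also have "\<dots> = (\<Sum>a\<in>A. card {q\<in>Q. a < q \<and> enat q < enat a + d} * ?e a)"
    by simp
  also have "\<dots> \<le> (\<Sum>a\<in>A. cap * ?e a)"
    using count by (intro sum_mono mult_right_mono) auto
  finally show ?thesis
    using \<open>0 < b\<close> by (simp add: sum_distrib_left mult.assoc mult.left_commute mult_left_mono)
qed

text \<open>The clairvoyant knows no batches. Its sales are placed into them in chronological order;
  by pigeonhole, a total load below the total capacity leaves room in some batch that exists at that
  time.\<close>

lemma greedy_assignment:
  fixes n :: "nat \<Rightarrow> nat" and cap :: "nat \<Rightarrow> nat"
  assumes "finite Q" and "\<And>q. q \<in> Q \<Longrightarrow> card (active d Q q) < (\<Sum>j<n q. cap j)"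
  shows "\<exists>\<beta>. \<forall>q\<in>Q. \<beta> q < n q \<and> card (active d {q'\<in>Q. \<beta> q' = \<beta> q} q) < cap (\<beta> q)"
  using assms
proof (induction rule: finite_linorder_max_induct)
  case (insert m Q)
  \<comment> \<open>\<open>active\<close> counts strictly earlier times, so the new maximum
    \<open>m\<close> changes no load at \<open>q \<le> m\<close>, not even at \<open>m\<close>
    itself, and earlier placements stay valid.\<close>
  have act: "active d {q'\<in>insert m Q. P q'} q = active d {q'\<in>Q. P q'} q" if "q \<le> m" for P q
    using that by (auto simp: active_def)
  have act_all: "active d (insert m Q) q = active d Q q" if "q \<le> m" for q
    using that by (auto simp: active_def)
  have "card (active d Q q) < (\<Sum>j<n q. cap j)" if "q \<in> Q" for q
    using act_all[of q] insert.prems[of q] insert.hyps(2) that by (simp add: less_imp_le)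
  then obtain \<beta> where \<beta>: "\<And>q. q \<in> Q \<Longrightarrow> \<beta> q < n q \<and> card (active d {q'\<in>Q. \<beta> q' = \<beta> q} q) < cap (\<beta> q)"
    using insert.IH by blast
  obtain j where j: "j < n m" "card (active d {q'\<in>Q. \<beta> q' = j} m) < cap j"
  proof (rule ccontr)
    assume "\<not> thesis"
    with that have "(\<Sum>j<n m. cap j) \<le> (\<Sum>j<n m. card (active d {q'\<in>Q. \<beta> q' = j} m))"
      by (intro sum_mono) (force simp: not_less)
    also have "\<dots> = card (\<Union>j<n m. active d {q'\<in>Q. \<beta> q' = j} m)"
      using insert.hyps(1) by (intro card_UN_disjoint[symmetric]) (auto simp: active_def)
    also have "\<dots> \<le> card (active d Q m)"
      using insert.hyps(1) by (intro card_mono) (auto simp: active_def)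
    also have "\<dots> < (\<Sum>j<n m. cap j)"
      using insert.prems[of m] act_all[of m] by simp
    finally show False by simp
  qed
  have ne: "m \<notin> Q" using insert.hyps(2) by blast
  let ?\<beta> = "\<beta>(m := j)"
  have upd: "{q'\<in>Q. ?\<beta> q' = k} = {q'\<in>Q. \<beta> q' = k}" for k
    using ne by auto
  have "?\<beta> q < n q \<and> card (active d {q'\<in>insert m Q. ?\<beta> q' = ?\<beta> q} q) < cap (?\<beta> q)" if "q \<in> insert m Q" for q
  proof (cases "q = m")
    case True
    then show ?thesis using j act[of m "\<lambda>q'. ?\<beta> q' = j"] by (simp only: upd) simp
  next
    case False
    then have "q \<in> Q" "q < m" using that insert.hyps(2) by auto
    then show ?thesis using \<beta>[of q] act[of q "\<lambda>q'. ?\<beta> q' = ?\<beta> q"] False by (simp only: upd) simp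
  qed
  then show ?case by blast
qed auto


section \<open>Policies with finite support\<close>

lemma expectation_bind_pmf_finite:
  fixes F :: "'b \<Rightarrow> real"
  assumes "finite (set_pmf p)" "\<And>x. x \<in> set_pmf p \<Longrightarrow> finite (set_pmf (f x))"
  shows "measure_pmf.expectation (bind_pmf p f) F
           = measure_pmf.expectation p (\<lambda>x. measure_pmf.expectation (f x) F)"
  by (subst pmf_expectation_bind[OF assms(1,2) order_refl])
     (auto simp: integral_measure_pmf[OF assms(1)])

lemma expectation_mono_finite:
  fixes F G :: "'a \<Rightarrow> real"
  assumes "finite (set_pmf p)" "\<And>x. x \<in> set_pmf p \<Longrightarrow> F x \<le> G x"
  shows "measure_pmf.expectation p F \<le> measure_pmf.expectation p G"
  by (intro integral_mono_AE integrable_measure_pmf_finite assms(1)) (simp add: AE_measure_pmf_iff assms(2))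

lemma expectation_cong_pmf:
  fixes F G :: "'a \<Rightarrow> real"
  assumes "\<And>x. x \<in> set_pmf p \<Longrightarrow> F x = G x"
  shows "measure_pmf.expectation p F = measure_pmf.expectation p G"
  by (intro integral_cong_AE) (simp_all add: AE_measure_pmf_iff assms)

definition sale :: "(nat \<Rightarrow> real) \<Rightarrow> nat option \<Rightarrow> real" where
  "sale g c = (case c of None \<Rightarrow> 0 | Some i \<Rightarrow> g i)"

lemma sale_simps [simp]: "sale g None = 0" "sale g (Some i) = g i"
  by (simp_all add: sale_def)

lemma set_history_pmf_Suc:
  "set_pmf (history_pmf P arr \<pi> (Suc k)) =
     {h @ [(S, c)] | h S c. h \<in> set_pmf (history_pmf P arr \<pi> k) \<and> S \<in> set_pmf (\<pi> h) \<and>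
        c \<in> set_pmf (choice_pmf P (fst (arr ! k)) S)}"
  by (auto simp: set_bind_pmf)

lemma length_history:
  "h \<in> set_pmf (history_pmf P arr \<pi> k) \<Longrightarrow> length h = k"
  by (induction k arbitrary: h) auto

lemma take_history:
  "h \<in> set_pmf (history_pmf P arr \<pi> k) \<Longrightarrow> t \<le> k \<Longrightarrow> take t h \<in> set_pmf (history_pmf P arr \<pi> t)"
proof (induction k arbitrary: h)
  case (Suc k)
  then show ?case
    by (cases "t = Suc k")
       (auto simp: set_history_pmf_Suc length_history le_Suc_eq simp del: history_pmf.simps(2))
qed simp

lemma history_nth:
  assumes "h \<in> set_pmf (history_pmf P arr \<pi> k)" "t < k"
  shows "fst (h ! t) \<in> set_pmf (\<pi> (take t h))"
    and "snd (h ! t) \<in> set_pmf (choice_pmf P (fst (arr ! t)) (fst (h ! t)))"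
proof -
  have "take (Suc t) h \<in> set_pmf (history_pmf P arr \<pi> (Suc t))"
    using assms by (intro take_history) auto
  moreover have "take (Suc t) h = take t h @ [(fst (h ! t), snd (h ! t))]"
    using assms by (simp add: take_Suc_conv_app_nth length_history)
  ultimately show "fst (h ! t) \<in> set_pmf (\<pi> (take t h))"
    and "snd (h ! t) \<in> set_pmf (choice_pmf P (fst (arr ! t)) (fst (h ! t)))"
    unfolding set_history_pmf_Suc by auto
qed

text \<open>Allows later periods to be dropped from the expectation of a quantity that depends on a
  prefix only.\<close>

lemma map_take_history_pmf:
  "map_pmf (take t) (history_pmf P arr \<pi> (t + m)) = history_pmf P arr \<pi> t"
proof (induction m)
  case 0
  have "map_pmf (take t) (history_pmf P arr \<pi> t) = map_pmf id (history_pmf P arr \<pi> t)"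
    by (intro map_pmf_cong) (simp_all add: length_history)
  then show ?case by simp
next
  case (Suc m)
  have "map_pmf (take t) (history_pmf P arr \<pi> (t + Suc m))
      = bind_pmf (history_pmf P arr \<pi> (t + m)) (\<lambda>h. return_pmf (take t h))"
    by (auto simp: map_bind_pmf length_history intro!: bind_pmf_cong)
  also have "\<dots> = map_pmf (take t) (history_pmf P arr \<pi> (t + m))"
    by (simp add: map_pmf_def)
  finally show ?case using Suc.IH by simp
qed

section \<open>Instances and the law of a single choice\<close>

locale input =
  fixes P :: products and arr :: "period list"
  assumes products: "valid_products P" and arrivals: "valid_arrivals P arr"
begin

lemma finite_items [simp]: "finite (items P)"
  by (simp add: items_def)

lemma assorts_subset: "S \<in> assorts P \<Longrightarrow> S \<subseteq> items P"
  using products by (auto simp: valid_products_def)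

lemma finite_assorts: "finite (assorts P)"
  using products by (auto simp: valid_products_def intro: finite_subset)

lemma assorts_downward: "S \<in> assorts P \<Longrightarrow> S' \<subseteq> S \<Longrightarrow> S' \<in> assorts P"
  using products by (auto simp: valid_products_def)

lemma empty_in_assorts: "{} \<in> assorts P"
  using products by (auto simp: valid_products_def)

lemma price_nonneg: "i \<in> items P \<Longrightarrow> 0 \<le> price P i"
  using products by (auto simp: valid_products_def)

lemma init_pos: "i \<in> items P \<Longrightarrow> 0 < init P i"
  using products by (auto simp: valid_products_def)

lemma choice_valid: "k < length arr \<Longrightarrow> valid_choice P (fst (arr ! k))"
  using arrivals nth_mem[of k arr] by (cases "arr ! k") (auto simp: valid_arrivals_def)

lemma choice_nonneg: "k < length arr \<Longrightarrow> S \<in> assorts P \<Longrightarrow> 0 \<le> fst (arr ! k) S i"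
  using choice_valid by (auto simp: valid_choice_def)

lemma choice_outside: "k < length arr \<Longrightarrow> S \<in> assorts P \<Longrightarrow> i \<notin> S \<Longrightarrow> fst (arr ! k) S i = 0"
  using choice_valid by (auto simp: valid_choice_def)

text \<open>\<open>embed_pmf\<close> is meaningful only for a density of total mass one. A valid
  choice model puts its mass on the finitely many items, and \<open>None\<close> takes up the
  remainder.\<close>

lemma pmf_choice:
  assumes "k < length arr" "S \<in> assorts P"
  shows "pmf (choice_pmf P (fst (arr ! k)) S) x =
           (case x of None \<Rightarrow> 1 - (\<Sum>i\<in>items P. fst (arr ! k) S i) | Some i \<Rightarrow> fst (arr ! k) S i)"
    (is "_ = ?f x")
  unfolding choice_pmf_def
proof (rule pmf_embed_pmf)
  let ?\<phi> = "fst (arr ! k)"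
  have sum1: "(\<Sum>i\<in>items P. ?\<phi> S i) \<le> 1"
    using choice_valid[OF assms(1)] assms(2) by (simp add: valid_choice_def)
  show nonneg: "0 \<le> ?f x" for x
    using sum1 choice_nonneg[OF assms] by (auto split: option.split)
  have supp: "?f x = 0" if "x \<notin> insert None (Some ` items P)" for x
    using that choice_outside[OF assms] assorts_subset[OF assms(2)] by (fastforce split: option.splits)
  have "(\<integral>\<^sup>+x. ennreal (?f x) \<partial>count_space UNIV) = (\<Sum>x\<in>insert None (Some ` items P). ennreal (?f x))"
  proof (rule nn_integral_count_space')
    fix x assume "x \<notin> insert None (Some ` items P)"
    then have "?f x = 0" by (rule supp)
    then show "ennreal (?f x) = 0" by simp
  qed simp_all
  also have "\<dots> = ennreal (\<Sum>x\<in>insert None (Some ` items P). ?f x)"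
    using nonneg by (intro sum_ennreal)
  also have "(\<Sum>x\<in>insert None (Some ` items P). ?f x) = 1"
    by (simp add: sum.reindex image_iff)
  finally show "(\<integral>\<^sup>+x. ennreal (?f x) \<partial>count_space UNIV) = 1" by simp
qed

lemma Some_in_set_choice:
  assumes "k < length arr" "S \<in> assorts P" "Some i \<in> set_pmf (choice_pmf P (fst (arr ! k)) S)"
  shows "fst (arr ! k) S i \<noteq> 0" "i \<in> S"
  using assms choice_outside[OF assms(1,2), of i] by (auto simp: set_pmf_eq pmf_choice)

lemma set_choice_subset:
  assumes "k < length arr" "S \<in> assorts P"
  shows "set_pmf (choice_pmf P (fst (arr ! k)) S) \<subseteq> insert None (Some ` items P)"
proof
  fix c assume "c \<in> set_pmf (choice_pmf P (fst (arr ! k)) S)"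
  then show "c \<in> insert None (Some ` items P)"
    using Some_in_set_choice(2)[OF assms] assorts_subset[OF assms(2)] by (cases c) auto
qed

lemma finite_set_choice:
  assumes "k < length arr" "S \<in> assorts P"
  shows "finite (set_pmf (choice_pmf P (fst (arr ! k)) S))"
  using set_choice_subset[OF assms] by (rule finite_subset) simp

text \<open>The constant \<open>a\<close> stands for what was collected in earlier periods, as it
  occurs in the induction over periods.\<close>

lemma expectation_choice:
  assumes "k < length arr" "S \<in> assorts P"
  shows "measure_pmf.expectation (choice_pmf P (fst (arr ! k)) S) (\<lambda>c. a + sale g c)
           = a + (\<Sum>i\<in>items P. g i * fst (arr ! k) S i)"
proof -
  let ?p = "choice_pmf P (fst (arr ! k)) S"
  have "measure_pmf.expectation ?p (\<lambda>c. a + sale g c) = a + measure_pmf.expectation ?p (sale g)"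
    using finite_set_choice[OF assms] by (subst Bochner_Integration.integral_add)
      (simp_all add: integrable_measure_pmf_finite)
  also have "measure_pmf.expectation ?p (sale g) = (\<Sum>c\<in>insert None (Some ` items P). pmf ?p c *\<^sub>R sale g c)"
    using set_choice_subset[OF assms] by (intro integral_measure_pmf) auto
  also have "\<dots> = (\<Sum>i\<in>items P. g i * fst (arr ! k) S i)"
    by (simp add: sum.reindex image_iff pmf_choice[OF assms] mult.commute)
  finally show ?thesis .
qed

end

section \<open>Feasible policies\<close>

locale feasible = input +
  fixes \<pi> :: policy
  assumes feasible: "feasible_policy P arr \<pi>"
begin

lemma offers_feasible:
  "k < length arr \<Longrightarrow> h \<in> set_pmf (history_pmf P arr \<pi> k) \<Longrightarrow> S \<in> set_pmf (\<pi> h)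
     \<Longrightarrow> S \<in> feasible_offers P arr h"
  using feasible by (auto simp: feasible_policy_def)

lemma offers_assorts:
  "k < length arr \<Longrightarrow> h \<in> set_pmf (history_pmf P arr \<pi> k) \<Longrightarrow> S \<in> set_pmf (\<pi> h) \<Longrightarrow> S \<in> assorts P"
  using offers_feasible by (auto simp: feasible_offers_def)

lemma finite_offers:
  "k < length arr \<Longrightarrow> h \<in> set_pmf (history_pmf P arr \<pi> k) \<Longrightarrow> finite (set_pmf (\<pi> h))"
  by (rule finite_subset[OF _ finite_assorts]) (auto simp: offers_assorts)

text \<open>Feasibility forces all offers into the finite set \<open>assorts P\<close>. Hence every
  real function of the history is integrable.\<close>

lemma finite_history: "k \<le> length arr \<Longrightarrow> finite (set_pmf (history_pmf P arr \<pi> k))"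
  by (induction k) (auto intro!: finite_offers finite_set_choice offers_assorts simp: Suc_le_eq)

lemma expectation_history_Suc:
  fixes F :: "history \<Rightarrow> real"
  assumes k: "k < length arr"
  shows "measure_pmf.expectation (history_pmf P arr \<pi> (Suc k)) F =
    measure_pmf.expectation (history_pmf P arr \<pi> k) (\<lambda>h. measure_pmf.expectation (\<pi> h)
      (\<lambda>S. measure_pmf.expectation (choice_pmf P (fst (arr ! k)) S) (\<lambda>c. F (h @ [(S, c)]))))"
proof -
  let ?c = "\<lambda>S. choice_pmf P (fst (arr ! k)) S"
  have fin: "finite (set_pmf (?c S))" if "h \<in> set_pmf (history_pmf P arr \<pi> k)" "S \<in> set_pmf (\<pi> h)" for h S
    using finite_set_choice[OF k offers_assorts[OF k that]] .
  have "measure_pmf.expectation (history_pmf P arr \<pi> (Suc k)) F =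
     measure_pmf.expectation (history_pmf P arr \<pi> k) (\<lambda>h. measure_pmf.expectation
       (bind_pmf (\<pi> h) (\<lambda>S. bind_pmf (?c S) (\<lambda>c. return_pmf (h @ [(S, c)])))) F)"
    using k fin finite_offers[OF k] unfolding history_pmf.simps
    by (intro expectation_bind_pmf_finite finite_history) auto
  also have "\<dots> = measure_pmf.expectation (history_pmf P arr \<pi> k) (\<lambda>h. measure_pmf.expectation (\<pi> h)
      (\<lambda>S. measure_pmf.expectation (?c S) (\<lambda>c. F (h @ [(S, c)]))))"
  proof (rule expectation_cong_pmf)
    fix h assume h: "h \<in> set_pmf (history_pmf P arr \<pi> k)"
    have "measure_pmf.expectation (bind_pmf (\<pi> h) (\<lambda>S. bind_pmf (?c S) (\<lambda>c. return_pmf (h @ [(S, c)])))) F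
      = measure_pmf.expectation (\<pi> h)
          (\<lambda>S. measure_pmf.expectation (bind_pmf (?c S) (\<lambda>c. return_pmf (h @ [(S, c)]))) F)"
      using fin[OF h] finite_offers[OF k h] by (intro expectation_bind_pmf_finite) auto
    also have "\<dots> = measure_pmf.expectation (\<pi> h) (\<lambda>S. measure_pmf.expectation (?c S) (\<lambda>c. F (h @ [(S, c)])))"
      using fin[OF h] by (intro expectation_cong_pmf) (subst expectation_bind_pmf_finite, auto)
    finally show "measure_pmf.expectation (bind_pmf (\<pi> h) (\<lambda>S. bind_pmf (?c S) (\<lambda>c. return_pmf (h @ [(S, c)])))) F
      = measure_pmf.expectation (\<pi> h) (\<lambda>S. measure_pmf.expectation (?c S) (\<lambda>c. F (h @ [(S, c)])))" .
  qed
  finally show ?thesis .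
qed

lemma sold:
  assumes "h \<in> set_pmf (history_pmf P arr \<pi> k)" "k \<le> length arr" "t < k" "snd (h ! t) = Some i"
  shows "i \<in> items P" "in_stock P arr (take t h) i" "i \<in> fst (h ! t)"
    "fst (arr ! t) (fst (h ! t)) i \<noteq> 0" "fst (h ! t) \<in> assorts P"
proof -
  have t: "t < length arr" using assms by simp
  have *: "take t h \<in> set_pmf (history_pmf P arr \<pi> t)"
    using assms by (intro take_history) auto
  note nth = history_nth[OF assms(1,3)]
  show S: "fst (h ! t) \<in> assorts P"
    using offers_assorts[OF t * nth(1)] .
  show "fst (arr ! t) (fst (h ! t)) i \<noteq> 0" and i: "i \<in> fst (h ! t)"
    using Some_in_set_choice[OF t S] nth(2) assms(4) by simp_all
  then show "in_stock P arr (take t h) i" "i \<in> items P"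
    using offers_feasible[OF t * nth(1)] assorts_subset[OF S] by (auto simp: feasible_offers_def)
qed

lemma revenue_sale: "revenue P h = (\<Sum>t<length h. sale (price P) (snd (h ! t)))"
  unfolding revenue_def sale_def by (simp add: sum_list_sum_nth case_prod_beta atLeast0LessThan)

text \<open>A crude bound that does not depend on the policy; it makes the supremum in
  \<open>OPT\<close> one over a bounded set.\<close>

lemma expected_revenue_le: "expected_revenue P arr \<pi> \<le> length arr * (\<Sum>i\<in>items P. price P i)"
proof -
  have "revenue P h \<le> length arr * (\<Sum>i\<in>items P. price P i)"
    if h: "h \<in> set_pmf (history_pmf P arr \<pi> (length arr))" for h
  proof -
    have "sale (price P) (snd (h ! t)) \<le> (\<Sum>i\<in>items P. price P i)" if "t < length h" for t
      using sold(1)[OF h order_refl, of t] that price_nonneg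
      by (cases "snd (h ! t)") (auto simp: length_history[OF h] intro!: sum_nonneg member_le_sum)
    then have "revenue P h \<le> of_nat (card {..<length h}) * (\<Sum>i\<in>items P. price P i)"
      unfolding revenue_sale by (intro sum_bounded_above) auto
    then show ?thesis by (simp add: length_history[OF h])
  qed
  then have "expected_revenue P arr \<pi> \<le>
      measure_pmf.expectation (history_pmf P arr \<pi> (length arr)) (\<lambda>_. length arr * (\<Sum>i\<in>items P. price P i))"
    unfolding expected_revenue_def by (intro expectation_mono_finite finite_history) auto
  then show ?thesis by simp
qed

end

section \<open>The benchmark as a supremum\<close>

context input
begin

lemma expected_revenue_le_OPT:
  assumes "feasible_policy P arr \<pi>"
  shows "expected_revenue P arr \<pi> \<le> OPT P arr"
  unfolding OPT_def
proof (rule cSUP_upper)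
  show "bdd_above (expected_revenue P arr ` {\<pi>. feasible_policy P arr \<pi>})"
  proof (rule bdd_aboveI2)
    fix \<pi> assume "\<pi> \<in> {\<pi>. feasible_policy P arr \<pi>}"
    then interpret feasible P arr \<pi> by unfold_locales simp
    show "expected_revenue P arr \<pi> \<le> length arr * (\<Sum>i\<in>items P. price P i)"
      by (rule expected_revenue_le)
  qed
qed (use assms in simp)

lemma OPT_le:
  assumes "\<And>\<pi>. feasible_policy P arr \<pi> \<Longrightarrow> expected_revenue P arr \<pi> \<le> C"
  shows "OPT P arr \<le> C"
  unfolding OPT_def
proof (rule cSUP_least)
  have "feasible_policy P arr (\<lambda>h. return_pmf {})"
    by (simp add: feasible_policy_def feasible_offers_def empty_in_assorts)
  then show "{\<pi>. feasible_policy P arr \<pi>} \<noteq> {}" by blast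
qed (use assms in simp)

end


section \<open>The adversary for bipartite matching\<close>

definition matching_products :: "nat \<Rightarrow> nat \<Rightarrow> products" where
  "matching_products n c =
     \<lparr>num = n, assorts = insert {} ((\<lambda>i. {i}) ` {1..n}), init = \<lambda>_. c, dur = \<lambda>_. \<infinity>, price = \<lambda>_. 1\<rparr>"

text \<open>Testing \<open>S = {i}\<close> leaves each \<open>S\<close> with at most one product of
  positive probability, and adding a product \<open>j \<noteq> i\<close> always makes the
  probability of \<open>i\<close> zero, which gives weak substitutability.\<close>

definition acceptance :: "nat set \<Rightarrow> period" where
  "acceptance N = ((\<lambda>S i. if S = {i} \<and> i \<in> N then 1 else 0), \<lambda>_. 0)"

definition sold :: "nat set \<Rightarrow> history \<Rightarrow> real" where
  "sold X h = (\<Sum>t<length h. sale (indicator X) (snd (h ! t)))"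

lemma items_matching [simp]: "items (matching_products n c) = {1..n}"
  by (simp add: items_def matching_products_def)

lemma matching_simps [simp]:
  "assorts (matching_products n c) = insert {} ((\<lambda>i. {i}) ` {1..n})"
  "init (matching_products n c) = (\<lambda>_. c)" "dur (matching_products n c) = (\<lambda>_. \<infinity>)"
  "price (matching_products n c) = (\<lambda>_. 1)"
  by (simp_all add: matching_products_def)

lemma sale_indicator_nonneg: "0 \<le> sale (indicator X) c"
  by (cases c) auto

lemma sale_indicator_le: "sale (indicator X) c \<le> 1"
  by (cases c) (auto split: split_indicator)

lemma sold_eq_sum:
  assumes "finite X"
  shows "sold X h = (\<Sum>i\<in>X. sold {i} h)"
proof -
  have "sale (indicator X) c = (\<Sum>i\<in>X. sale (indicator {i}) c)" for c
    using assms by (cases c) (auto simp: indicator_def)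
  then show ?thesis
    unfolding sold_def using sum.swap[of _ X] by simp
qed

lemma sold_singleton: "sold {i} h = card {t. t < length h \<and> snd (h ! t) = Some i}"
proof -
  have "sold {i} h = (\<Sum>t<length h. if snd (h ! t) = Some i then 1 else 0)"
    unfolding sold_def by (intro sum.cong refl) (auto simp: sale_def indicator_def split: option.split)
  also have "\<dots> = card {t \<in> {..<length h}. snd (h ! t) = Some i}"
    by (subst sum.inter_filter[symmetric]) auto
  finally show ?thesis by simp
qed

lemma valid_matching_products: "1 \<le> n \<Longrightarrow> 1 \<le> c \<Longrightarrow> valid_products (matching_products n c)"
  by (auto simp: valid_products_def matching_products_def items_def subset_singleton_iff)

lemma min_init_matching: "1 \<le> n \<Longrightarrow> min_init (matching_products n c) = c"
  by (simp add: min_init_def image_constant_conv)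

lemma valid_choice_acceptance: "valid_choice (matching_products n c) (fst (acceptance N))"
proof -
  have "(\<Sum>j = 1..n. if {i} = {j} \<and> j \<in> N then 1 else 0) \<le> (\<Sum>j = 1..n. if j = i then 1 else (0::real))" for i
    by (intro sum_mono) auto
  also have "\<dots> i \<le> 1" for i by simp
  finally show ?thesis
    by (auto simp: valid_choice_def weakly_substitutable_def acceptance_def)
qed

lemma valid_arrivals_acceptance:
  "valid_arrivals (matching_products n c) (map acceptance Ns)"
  by (simp add: valid_arrivals_def case_prod_beta valid_choice_acceptance)

lemma vertex_weighted_b_matching_acceptance:
  "vertex_weighted_b_matching (matching_products n c) (map acceptance Ns)"
proof -
  have "\<exists>N\<subseteq>{1..n}. \<forall>i\<in>{1..n}. fst (acceptance M) {i} i = (if i \<in> N then 1 else 0)" for M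
    by (intro exI[of _ "M \<inter> {1..n}"]) (auto simp: acceptance_def)
  moreover have "snd (acceptance M) i = 0" for M i
    by (simp add: acceptance_def)
  ultimately show ?thesis
    by (auto simp: vertex_weighted_b_matching_def no_shocks_def case_prod_beta)
qed

text \<open>Offering the planned product of each period is a policy with a deterministic history,
  because every such offer is accepted with certainty.\<close>

lemma plan_le_OPT:
  assumes "1 \<le> n" "1 \<le> c"
    and plan: "list_all2 (\<in>) plan Ns" "set plan \<subseteq> {1..n}" "\<And>i. count_list plan i \<le> c"
  shows "real (length plan) \<le> OPT (matching_products n c) (map acceptance Ns)"
proof -
  let ?P = "matching_products n c" and ?arr = "map acceptance Ns"
  let ?\<pi> = "\<lambda>h. return_pmf {plan ! length h}"
  interpret input ?P ?arr
    using assms valid_matching_products valid_arrivals_acceptance by unfold_locales auto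
  have len: "length plan = length Ns" using plan(1) by (rule list_all2_lengthD)
  have item: "plan ! t \<in> {1..n}" if "t < length plan" for t
    using plan(2) nth_mem[OF that] by blast
  define path where "path k = map (\<lambda>t. ({plan ! t}, Some (plan ! t))) [0..<k]" for k
  have accept: "choice_pmf ?P (fst (?arr ! k)) {plan ! k} = return_pmf (Some (plan ! k))"
    if "k < length plan" for k
  proof -
    have "plan ! k \<in> Ns ! k" using plan(1) that by (rule list_all2_nthD)
    moreover have "{plan ! k} \<in> assorts ?P" using item[OF that] by simp
    moreover have "(\<Sum>i\<in>items ?P. fst (?arr ! k) {plan ! k} i) = (\<Sum>i\<in>items ?P. if i = plan ! k then 1 else 0)"
      using calculation that len by (intro sum.cong) (auto simp: acceptance_def)
    ultimately have "pmf (choice_pmf ?P (fst (?arr ! k)) {plan ! k}) c = (if c = Some (plan ! k) then 1 else 0)" for c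
      using that len item[OF that] by (subst pmf_choice) (auto simp: acceptance_def split: option.split)
    then show ?thesis
      by (intro pmf_eqI) simp
  qed
  have hist: "history_pmf ?P ?arr ?\<pi> k = return_pmf (path k)" if "k \<le> length plan" for k
    using that
  proof (induction k)
    case (Suc k)
    have "length (path k) = k" by (simp add: path_def)
    with Suc show ?case
      by (simp add: bind_return_pmf accept Suc_le_eq) (simp add: path_def)
  qed (simp add: path_def)
  have feas: "feasible_policy ?P ?arr ?\<pi>"
    unfolding feasible_policy_def
  proof (intro allI impI ballI)
    fix k h assume k: "k < length ?arr" and "h \<in> set_pmf (history_pmf ?P ?arr ?\<pi> k)"
    then have h: "h = path k" "length h = k"
      using hist[of k] len by (auto simp: path_def)
    let ?i = "plan ! k"
    have "in_use \<infinity> (map snd h) ?i = card {t. t < k \<and> plan ! t = ?i}"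
      unfolding in_use_def h(1) by (rule arg_cong[of _ _ card]) (auto simp: path_def)
    \<comment> \<open>The plan spends a unit of \<open>?i\<close> in period \<open>k\<close> too,
      and this one is not yet in use; hence the strict inequality.\<close>
    also have "\<dots> < card (insert k {t. t < k \<and> plan ! t = ?i})"
      by (subst card_insert_disjoint) auto
    also have "\<dots> \<le> card {t. t < length plan \<and> ?i = plan ! t}"
      using k len by (intro card_mono) auto
    also have "\<dots> = count_list plan ?i"
      by (simp add: count_list_eq_length_filter length_filter_conv_card)
    also have "\<dots> \<le> c" by (rule plan(3))
    finally have "in_stock ?P ?arr h ?i"
      by (simp add: in_stock_def)
    then show "set_pmf (?\<pi> h) \<subseteq> feasible_offers ?P ?arr h"
      using item[of k] k h len by (simp add: feasible_offers_def)
  qed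
  have "expected_revenue ?P ?arr ?\<pi> = revenue ?P (path (length plan))"
    unfolding expected_revenue_def using hist[OF order_refl] len by simp
  also have "\<dots> = length plan"
    by (simp add: revenue_def path_def sum_list_triv comp_def)
  finally show ?thesis
    using expected_revenue_le_OPT[OF feas] by simp
qed

section \<open>Expected sales of an online algorithm\<close>

locale adversary =
  fixes A :: algorithm and n c :: nat
  assumes online: "online_algorithm A" and n: "1 \<le> n" and c: "1 \<le> c"
begin

abbreviation "P \<equiv> matching_products n c"

abbreviation "hist Ns \<equiv> history_pmf P (map acceptance Ns) (run A P (map acceptance Ns))"

definition exp_sold :: "nat set list \<Rightarrow> nat set \<Rightarrow> real" where
  "exp_sold Ns X = measure_pmf.expectation (hist Ns (length Ns)) (sold X)"

lemma feasible_run: "feasible P (map acceptance Ns) (run A P (map acceptance Ns))"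
  using online n c valid_matching_products valid_arrivals_acceptance
  by unfold_locales (auto simp: online_algorithm_def)

lemma finite_hist: "k \<le> length Ns \<Longrightarrow> finite (set_pmf (hist Ns k))"
  using feasible.finite_history[OF feasible_run] by simp

lemma exp_sold_sum: "finite X \<Longrightarrow> exp_sold Ns X = (\<Sum>i\<in>X. exp_sold Ns {i})"
  unfolding exp_sold_def
  by (subst Bochner_Integration.integral_sum[symmetric])
     (auto simp: sold_eq_sum[symmetric] integrable_measure_pmf_finite finite_hist intro!: Bochner_Integration.integral_cong)

lemma exp_sold_split:
  assumes "N \<subseteq> {1..n}"
  shows "exp_sold Ns {1..n} = exp_sold Ns ({1..n} - N) + (\<Sum>i\<in>N. exp_sold Ns {i})"
  using exp_sold_sum[of "{1..n}" Ns] exp_sold_sum[of "{1..n} - N" Ns]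
    sum.subset_diff[OF assms, of "\<lambda>i. exp_sold Ns {i}"] by simp

lemma exp_sold_nonneg: "0 \<le> exp_sold Ns X"
  unfolding exp_sold_def sold_def by (intro Bochner_Integration.integral_nonneg sum_nonneg sale_indicator_nonneg)

lemma exp_sold_le_length: "exp_sold Ns X \<le> length Ns"
proof -
  have "sold X h \<le> length Ns" if "h \<in> set_pmf (hist Ns (length Ns))" for h
    unfolding sold_def length_history[OF that]
    using sum_bounded_above[of "{..<length Ns}", OF sale_indicator_le] by simp
  then have "exp_sold Ns X \<le> measure_pmf.expectation (hist Ns (length Ns)) (\<lambda>_. real (length Ns))"
    unfolding exp_sold_def by (intro expectation_mono_finite finite_hist) auto
  then show ?thesis by simp
qed

lemma exp_sold_le_capacity: "exp_sold Ns {i} \<le> c"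
proof -
  interpret feasible P "map acceptance Ns" "run A P (map acceptance Ns)" by (rule feasible_run)
  have "sold {i} h \<le> c" if h: "h \<in> set_pmf (hist Ns (length Ns))" for h
  proof -
    let ?T = "{t. t < length h \<and> snd (h ! t) = Some i}"
    have "card ?T \<le> c"
    proof (cases "?T = {}")
      case False
      define t where "t = Max ?T"
      have t: "t \<in> ?T" unfolding t_def using False by (intro Max_in) auto
      have "s \<le> t" if "s \<in> ?T" for s
        using that by (simp add: t_def)
      then have "?T = insert t {s. s < t \<and> snd (h ! s) = Some i}"
        using t by (auto simp: le_less)
      then have "card ?T = Suc (card {s. s < t \<and> snd (h ! s) = Some i})" by simp
      also have "{s. s < t \<and> snd (h ! s) = Some i} = {s. s < length (map snd (take t h)) \<and> map snd (take t h) ! s = Some i}"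
        using t by auto
      finally have "card ?T = Suc (in_use \<infinity> (map snd (take t h)) i)"
        by (simp add: in_use_def)
      moreover have "in_stock P (map acceptance Ns) (take t h) i"
        using t h by (intro sold(2)) (auto simp: length_history[OF h])
      moreover have "(\<Sum>(\<phi>, \<xi>)\<leftarrow>map acceptance Ms. \<xi> i) = 0" for Ms
        by (induction Ms) (simp_all add: acceptance_def)
      ultimately show ?thesis by (simp only: in_stock_def take_map) simp
    qed (simp only: card.empty)
    then show ?thesis by (simp add: sold_singleton)
  qed
  then have "exp_sold Ns {i} \<le> measure_pmf.expectation (hist Ns (length Ns)) (\<lambda>_. real c)"
    unfolding exp_sold_def by (intro expectation_mono_finite finite_hist) auto
  then show ?thesis by simp
qed

text \<open>Here the online property enters: \<open>run\<close> passes on only the periods revealed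
  so far, so appended consumers cannot change the law of earlier periods.\<close>

lemma hist_append: "k \<le> length Ns \<Longrightarrow> hist (Ns @ Ms) k = hist Ns k"
proof (induction k)
  case (Suc k)
  then have IH: "hist (Ns @ Ms) k = hist Ns k" by simp
  show ?case
    unfolding history_pmf.simps IH
  proof (intro bind_pmf_cong refl)
    fix h assume "h \<in> set_pmf (hist Ns k)"
    then show "run A P (map acceptance (Ns @ Ms)) h = run A P (map acceptance Ns) h"
      using Suc.prems by (simp add: run_def length_history)
  qed (use Suc.prems in \<open>simp add: nth_append\<close>)
qed simp

text \<open>Consumers who accept nothing in \<open>X\<close> buy nothing in \<open>X\<close>, so the
  sales of retired products are final.\<close>

lemma exp_sold_append:
  assumes "\<And>N. N \<in> set Ms \<Longrightarrow> N \<inter> X = {}"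
  shows "exp_sold (Ns @ Ms) X = exp_sold Ns X"
proof -
  interpret feasible P "map acceptance (Ns @ Ms)" "run A P (map acceptance (Ns @ Ms))"
    by (rule feasible_run)
  let ?k = "length Ns" and ?l = "length Ns + length Ms"
  have "exp_sold (Ns @ Ms) X = measure_pmf.expectation (hist (Ns @ Ms) ?l) (\<lambda>h. sold X (take ?k h))"
    unfolding exp_sold_def length_append
  proof (rule expectation_cong_pmf)
    fix h assume h: "h \<in> set_pmf (hist (Ns @ Ms) ?l)"
    have "sale (indicator X) (snd (h ! t)) = 0" if t: "t < ?l" "\<not> t < ?k" for t
    proof (cases "snd (h ! t)")
      case (Some i)
      have "fst (map acceptance (Ns @ Ms) ! t) (fst (h ! t)) i \<noteq> 0"
        using h t Some by (intro sold(4)) auto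
      then have "i \<in> (Ns @ Ms) ! t"
        using t by (auto simp: acceptance_def simp del: map_append split: if_splits)
      moreover have "(Ns @ Ms) ! t \<in> set Ms"
        using t by (simp add: nth_append)
      ultimately have "i \<notin> X" using assms by blast
      then show ?thesis using Some by simp
    qed simp
    then have "sold X h = (\<Sum>t | t < ?l \<and> t < ?k. sale (indicator X) (snd (h ! t)))"
      unfolding sold_def length_history[OF h] by (intro sum.mono_neutral_right) auto
    also have "\<dots> = sold X (take ?k h)"
      unfolding sold_def using length_history[OF h] by (intro sum.cong) auto
    finally show "sold X h = sold X (take ?k h)" .
  qed
  also have "\<dots> = measure_pmf.expectation (map_pmf (take ?k) (hist (Ns @ Ms) ?l)) (sold X)"
    by simp
  also have "\<dots> = exp_sold Ns X"
    by (simp only: map_take_history_pmf hist_append order_refl exp_sold_def)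
  finally show ?thesis .
qed

lemma expected_revenue_eq_exp_sold:
  "expected_revenue P (map acceptance Ns) (run A P (map acceptance Ns)) = exp_sold Ns {1..n}"
proof -
  interpret feasible P "map acceptance Ns" "run A P (map acceptance Ns)" by (rule feasible_run)
  show ?thesis
    unfolding expected_revenue_def exp_sold_def length_map
  proof (rule expectation_cong_pmf)
    fix h assume h: "h \<in> set_pmf (hist Ns (length Ns))"
    have "sale (price P) (snd (h ! t)) = sale (indicator {1..n}) (snd (h ! t))" if "t < length h" for t
      using sold(1)[OF h, of t] that by (cases "snd (h ! t)") (auto simp: length_history[OF h])
    then show "revenue P h = sold {1..n} h"
      unfolding revenue_sale sold_def by simp
  qed
qed

text \<open>The adversary retires the remaining product of least expected sales. As it does not exceed the
  average, the retired products have sold no more than under the algorithm that serves all remaining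
  products evenly, for which the bound below is an equality.\<close>

lemma retire:
  assumes "k \<le> n"
  shows "\<exists>Ns plan N. length Ns = k * c \<and> N \<subseteq> {1..n} \<and> card N = n - k \<and>
     list_all2 (\<in>) plan Ns \<and> set plan \<subseteq> {1..n} \<and>
     (\<forall>i. count_list plan i = (if i \<in> {1..n} - N then c else 0)) \<and>
     exp_sold Ns ({1..n} - N) \<le> c * (k - real (n - k) * (\<Sum>j<k. 1 / real (n - j)))"
  using assms
proof (induction k)
  case 0
  have "exp_sold [] {} = 0"
    by (simp add: exp_sold_def sold_def)
  then show ?case by (intro exI[of _ "[]"] exI[of _ "{1..n}"]) simp
next
  case (Suc k)
  then obtain Ns plan N where *: "length Ns = k * c" "N \<subseteq> {1..n}" "card N = n - k"
      "list_all2 (\<in>) plan Ns" "set plan \<subseteq> {1..n}"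
      "\<And>i. count_list plan i = (if i \<in> {1..n} - N then c else 0)"
    and sold: "exp_sold Ns ({1..n} - N) \<le> c * (k - real (n - k) * (\<Sum>j<k. 1 / real (n - j)))"
    by auto
  define m where "m = n - k"
  have m: "m \<ge> 1" "card N = m" "real (n - Suc k) = real m - 1" "real n = real k + real m"
    using Suc.prems * by (auto simp: m_def)
  have finN: "finite N" and neN: "N \<noteq> {}"
    using m(1,2) card_gt_0_iff[of N] by auto
  let ?Ms = "Ns @ replicate c N"
  obtain r where r: "r \<in> N" "\<And>i. i \<in> N \<Longrightarrow> exp_sold ?Ms {r} \<le> exp_sold ?Ms {i}"
    using ex_min_if_finite[of "exp_sold ?Ms ` (\<lambda>i. {i}) ` N"] finN neN
    by (auto simp: not_less)
  have N': "{1..n} - (N - {r}) = insert r ({1..n} - N)"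
    using *(2) r(1) by auto
  define V where "V = exp_sold ?Ms ({1..n} - N)"
  define y where "y = exp_sold ?Ms {r}"
  have V: "V \<le> c * (k - m * (\<Sum>j<k. 1 / real (n - j)))"
    unfolding V_def using sold by (subst exp_sold_append) (auto simp: m_def)
  have V': "exp_sold ?Ms ({1..n} - (N - {r})) = V + y"
    unfolding N' V_def y_def
    using r(1) exp_sold_sum[of "insert r ({1..n} - N)" ?Ms] exp_sold_sum[of "{1..n} - N" ?Ms] by simp
  \<comment> \<open>\<open>y\<close> is the least of \<open>m\<close> values, and the
    \<open>(k + 1) * c\<close> consumers so far buy at most one unit each.\<close>
  have "V + m * y \<le> V + (\<Sum>i\<in>N. exp_sold ?Ms {i})"
    using sum_mono[of N "\<lambda>_. y" "\<lambda>i. exp_sold ?Ms {i}"] r(2) m(2) by (simp add: y_def)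
  also have "\<dots> = exp_sold ?Ms {1..n}"
    unfolding V_def exp_sold_split[OF *(2)] ..
  also have "\<dots> \<le> (k + 1) * c"
    using exp_sold_le_length[of ?Ms "{1..n}"] *(1) by (simp add: algebra_simps)
  finally have y: "y \<le> ((k + 1) * c - V) / m"
    using m(1) by (simp add: field_simps)
  define H where "H = (\<Sum>j<k. 1 / real (n - j))"
  have H: "(\<Sum>j<Suc k. 1 / real (n - j)) = H + 1 / m"
    by (simp add: H_def m_def)
  have "V + y \<le> V + ((k + 1) * c - V) / m"
    using y by simp
  also have "\<dots> = V * (1 - 1 / m) + (k + 1) * c / m"
    by (simp add: algebra_simps diff_divide_distrib)
  \<comment> \<open>The bound on \<open>y\<close> decreases in \<open>V\<close>, but in the sum
    \<open>V\<close> has the coefficient \<open>1 - 1 / m\<close>, nonnegative since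
    \<open>m \<ge> 1\<close>; so the induction bound on \<open>V\<close> may be inserted.\<close>
  also have "\<dots> \<le> (c * (k - m * H)) * (1 - 1 / m) + (k + 1) * c / m"
    using V m(1) by (intro add_right_mono mult_right_mono) (auto simp: H_def)
  also have "\<dots> = c * (Suc k - real (n - Suc k) * (H + 1 / m))"
    using m(1) unfolding m(3) by (simp add: field_simps)
  finally have sold': "V + y \<le> c * (Suc k - real (n - Suc k) * (\<Sum>j<Suc k. 1 / real (n - j)))"
    unfolding H .
  \<comment> \<open>The plan spends all \<open>c\<close> units of \<open>r\<close> on the phase just
    before its retirement, whose consumers still accept \<open>r\<close>.\<close>
  have cnt: "count_list (plan @ replicate c r) i = (if i \<in> {1..n} - (N - {r}) then c else 0)" for i
  proof -
    have "count_list (replicate c r) i = (if i = r then c else 0)"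
      by (induction c) auto
    then show ?thesis using *(2,6) r(1) by auto
  qed
  show ?case
  proof (intro exI conjI)
    show "length ?Ms = Suc k * c" using *(1) by simp
    show "N - {r} \<subseteq> {1..n}" using *(2) by blast
    show "card (N - {r}) = n - Suc k" using r(1) *(3) by simp
    show "list_all2 (\<in>) (plan @ replicate c r) ?Ms"
      using *(4) r(1) by (intro list_all2_appendI) (auto simp: list_all2_conv_all_nth)
    show "set (plan @ replicate c r) \<subseteq> {1..n}" using *(2,5) r(1) by auto
    show "\<forall>i. count_list (plan @ replicate c r) i = (if i \<in> {1..n} - (N - {r}) then c else 0)"
      using cnt by blast
    show "exp_sold ?Ms ({1..n} - (N - {r})) \<le> c * (Suc k - real (n - Suc k) * (\<Sum>j<Suc k. 1 / real (n - j)))"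
      unfolding V' by (rule sold')
  qed
qed

text \<open>Retirement stops when \<open>m\<close> products are left, and \<open>m * c\<close>
  further consumers accept exactly these. The clairvoyant sells all \<open>n * c\<close> units; the
  algorithm sells at most \<open>m * c\<close> units of the remaining products and is bounded by
  \<open>retire\<close> on the others.\<close>

lemma CR_le_harmonic:
  assumes "m \<le> n"
  shows "CR_on vertex_weighted_b_matching A c \<le> ereal (1 - m / n * (\<Sum>j<n - m. 1 / real (n - j)))"
proof -
  define k where "k = n - m"
  have k: "k \<le> n" "n - k = m" "k + m = n" "real k = real n - real m" using assms by (auto simp: k_def)
  obtain Ns plan N where *: "length Ns = k * c" "N \<subseteq> {1..n}" "card N = m"
      "list_all2 (\<in>) plan Ns" "set plan \<subseteq> {1..n}"
      "\<And>i. count_list plan i = (if i \<in> {1..n} - N then c else 0)"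
    and sold: "exp_sold Ns ({1..n} - N) \<le> c * (k - m * (\<Sum>j<k. 1 / real (n - j)))"
    using retire[OF k(1)] k(2) by auto
  have finN: "finite N" using *(2) finite_subset by blast
  then obtain xs where xs: "set xs = N" "distinct xs" "length xs = m"
    using finite_distinct_list[of N] *(3) distinct_card by metis
  let ?Ms = "Ns @ replicate (m * c) N" and ?plan = "plan @ concat (map (replicate c) xs)"
  let ?arr = "map acceptance ?Ms"
  have len: "length (concat (map (replicate c) ys)) = length ys * c" for ys :: "nat list"
    by (induction ys) auto
  have cnt: "count_list (concat (map (replicate c) ys)) i = count_list ys i * c" for ys :: "nat list" and i
  proof (induction ys)
    case (Cons y ys)
    have "count_list (replicate c y) i = (if y = i then c else 0)" by (induction c) auto
    with Cons show ?case by simp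
  qed simp
  have c_eq: "length ?plan = n * c"
    using *(1) xs k(3) len[of xs] list_all2_lengthD[OF *(4)] by (simp flip: distrib_right)
  have "real (length ?plan) \<le> OPT P ?arr"
  proof (rule plan_le_OPT[OF n c])
    show "list_all2 (\<in>) ?plan ?Ms"
      using *(4) xs len[of xs] nth_mem[of _ "concat (map (replicate c) xs)"]
      by (intro list_all2_appendI) (auto simp: list_all2_conv_all_nth)
    show "set ?plan \<subseteq> {1..n}" using *(2,5) xs(1) by auto
    show "count_list ?plan i \<le> c" for i
    proof -
      have "count_list ys i \<le> 1" if "distinct ys" for ys
        using that by (induction ys) (auto simp: count_list_0_iff)
      then show ?thesis
        using *(2,6) cnt[of xs i] xs(1,2) by (auto simp: count_list_0_iff)
    qed
  qed
  then have opt: "n * c \<le> OPT P ?arr" unfolding c_eq by simp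
  have nc: "0 < real (n * c)" using n c by simp
  then have opt_pos: "0 < OPT P ?arr" using opt by (rule less_le_trans)
  have "exp_sold ?Ms {1..n} = exp_sold ?Ms ({1..n} - N) + (\<Sum>i\<in>N. exp_sold ?Ms {i})"
    by (rule exp_sold_split[OF *(2)])
  also have "exp_sold ?Ms ({1..n} - N) = exp_sold Ns ({1..n} - N)"
    by (rule exp_sold_append) auto
  also have "\<dots> + (\<Sum>i\<in>N. exp_sold ?Ms {i}) \<le> c * (k - m * (\<Sum>j<k. 1 / real (n - j))) + (\<Sum>i\<in>N. real c)"
    using sold exp_sold_le_capacity by (intro add_mono sum_mono)
  also have "\<dots> = (1 - m / n * (\<Sum>j<k. 1 / real (n - j))) * (n * c)"
    using n by (simp add: *(3) k(4) field_simps)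
  finally have "exp_sold ?Ms {1..n} / (n * c) \<le> 1 - m / n * (\<Sum>j<k. 1 / real (n - j))"
    using n c by (simp add: divide_le_eq)
  moreover have "exp_sold ?Ms {1..n} / OPT P ?arr \<le> exp_sold ?Ms {1..n} / (n * c)"
    using opt nc opt_pos exp_sold_nonneg by (intro divide_left_mono mult_pos_pos)
  ultimately have "expected_revenue P ?arr (run A P ?arr) / OPT P ?arr \<le> 1 - m / n * (\<Sum>j<k. 1 / real (n - j))"
    unfolding expected_revenue_eq_exp_sold by linarith
  moreover have "length ?arr = n * c" using *(1) k(3) by (simp flip: distrib_right)
  then have "1 \<le> length ?arr" using n c by simp
  ultimately have "competitive_ratio_on vertex_weighted_b_matching A P
      \<le> ereal (1 - m / n * (\<Sum>j<k. 1 / real (n - j)))"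
    unfolding competitive_ratio_on_def
    using opt_pos valid_arrivals_acceptance[of n c ?Ms] vertex_weighted_b_matching_acceptance[of n c ?Ms]
    by (intro INF_lower2[of ?arr]) (auto simp del: map_append)
  then show ?thesis
    unfolding CR_on_def k_def using valid_matching_products[OF n c] min_init_matching[OF n]
    by (intro INF_lower2[of P]) auto
qed

end

text \<open>Telescoping of \<open>ln (x + 1) - ln x = ln (1 + 1 / x) \<le> 1 / x\<close>.\<close>

lemma ln_le_harmonic_diff:
  assumes "m \<le> n"
  shows "ln ((real n + 1) / (real m + 1)) \<le> (\<Sum>j<n - m. 1 / real (n - j))"
proof -
  have "ln (real n + 1) - ln (real n + 1 - real k) \<le> (\<Sum>j<k. 1 / real (n - j))" if "k \<le> n" for k
    using that
  proof (induction k)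
    case (Suc k)
    let ?x = "real (n - k)"
    have x: "?x \<ge> 1" "real n + 1 - real k = ?x + 1" "real n + 1 - real (Suc k) = ?x"
      using Suc.prems by auto
    have "ln (?x + 1) - ln ?x = ln ((?x + 1) / ?x)"
      using x(1) by (subst ln_div) auto
    also have "(?x + 1) / ?x = 1 + 1 / ?x"
      using x(1) by (simp add: add_divide_distrib)
    also have "ln (1 + 1 / ?x) \<le> 1 / ?x" using x(1) by (intro ln_add_one_self_le_self) simp
    finally show ?case using Suc x by simp
  qed simp
  from this[of "n - m"] show ?thesis using assms by (simp add: ln_div add.commute)
qed

text \<open>With \<open>m = x * n\<close> the bound of \<open>CR_le_harmonic\<close> tends to
  \<open>1 + x * ln x\<close>, which is least at \<open>x = 1/e\<close>. For given \<open>c\<close>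
  the number \<open>n\<close> of products is free and can tend to infinity.\<close>

lemma CR_on_matching_le:
  assumes "online_algorithm A" "1 \<le> c"
  shows "CR_on vertex_weighted_b_matching A c \<le> ereal (1 - 1 / exp 1)"
proof -
  \<comment> \<open>The \<open>2\<close> collects the rounding of \<open>m\<close> and the shift by
    one in \<open>ln_le_harmonic_diff\<close>. Rounding is upwards, so that \<open>m / n\<close>
    stays above \<open>1 / e\<close>.\<close>
  let ?f = "\<lambda>n. 1 - 1 / exp 1 * ln ((real n + 1) / (real n / exp 1 + 2))"
  have "(\<lambda>n. ereal (?f n)) \<longlonglongrightarrow> ereal (1 - 1 / exp 1)"
    unfolding lim_ereal by real_asymp
  moreover have "\<forall>\<^sub>F n in sequentially. CR_on vertex_weighted_b_matching A c \<le> ereal (?f n)"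
  proof (rule eventually_sequentiallyI)
    fix n :: nat assume n: "1 \<le> n"
    interpret adversary A n c using assms n by unfold_locales
    define m where "m = nat \<lceil>real n / exp 1\<rceil>"
    have m: "real n / exp 1 \<le> m" "m \<le> real n / exp 1 + 1"
      unfolding m_def by (simp_all add: of_nat_ceiling of_nat_nat)
    have "real n / exp 1 \<le> n / 1"
      by (intro divide_left_mono) auto
    then have mn: "m \<le> n" by (simp add: m_def nat_le_iff ceiling_le_iff)
    have "ln ((real n + 1) / (real n / exp 1 + 2)) \<le> ln ((real n + 1) / (real m + 1))"
      using m by (intro iffD2[OF ln_le_cancel_iff] divide_left_mono) (auto intro!: divide_pos_pos mult_pos_pos add_nonneg_pos)
    also have "\<dots> \<le> (\<Sum>j<n - m. 1 / real (n - j))"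
      by (rule ln_le_harmonic_diff[OF mn])
    finally have 1: "ln ((real n + 1) / (real n / exp 1 + 2)) \<le> (\<Sum>j<n - m. 1 / real (n - j))" .
    have 2: "1 / exp 1 \<le> real m / n" using m n by (simp add: field_simps)
    have "1 / exp 1 * ln ((real n + 1) / (real n / exp 1 + 2)) \<le> 1 / exp 1 * (\<Sum>j<n - m. 1 / real (n - j))"
      using 1 by (intro mult_left_mono) auto
    also have "\<dots> \<le> m / n * (\<Sum>j<n - m. 1 / real (n - j))"
      using 2 by (intro mult_right_mono sum_nonneg) auto
    finally have "ereal (1 - m / n * (\<Sum>j<n - m. 1 / real (n - j))) \<le> ereal (?f n)" by simp
    then show "CR_on vertex_weighted_b_matching A c \<le> ereal (?f n)"
      using CR_le_harmonic[OF mn] by (rule order_trans[rotated])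
  qed
  ultimately show ?thesis
    by (rule tendsto_lowerbound) simp
qed

lemma CR_on_antimono:
  assumes "\<And>P arr. K P arr \<Longrightarrow> K' P arr"
  shows "CR_on K' A c \<le> CR_on K A c"
  unfolding CR_on_def competitive_ratio_on_def
  using assms by (intro INF_mono') (auto intro!: INF_superset_mono)


section \<open>Feasibility of BIB\<close>

text \<open>Division of \<open>q + x\<close> by \<open>\<gamma>\<close> with remainder: the quotient
  counts the batches completed, the remainder is the charging batch.\<close>

lemma add_unit_pow:
  assumes "1 \<le> \<gamma>" "q < \<gamma>"
  shows "\<exists>m' q'. (add_unit \<gamma> ^^ x) (bs, q) = (bs @ replicate m' \<gamma>, q') \<and>
           q' < \<gamma> \<and> m' * \<gamma> + q' = q + x"
proof (induction x)
  case 0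
  show ?case using assms by (intro exI[of _ "0::nat"] exI[of _ q] conjI) simp_all
next
  case (Suc x)
  then obtain m' q' where *: "(add_unit \<gamma> ^^ x) (bs, q) = (bs @ replicate m' \<gamma>, q')"
      "q' < \<gamma>" "m' * \<gamma> + q' = q + x" by blast
  show ?case
  proof (cases "Suc q' = \<gamma>")
    case True
    then show ?thesis using * assms
      by (intro exI[of _ "Suc m'"] exI[of _ 0]) (auto simp: replicate_append_same)
  next
    case False
    then show ?thesis using * by (intro exI[of _ m'] exI[of _ "Suc q'"]) auto
  qed
qed

lemma fold_add_unit:
  assumes "1 \<le> \<gamma>"
  shows "\<exists>m q. fold (\<lambda>(\<phi>, \<xi>). add_unit \<gamma> ^^ \<xi> i) ar ([c], 0) = (c # replicate m \<gamma>, q) \<and>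
           q < \<gamma> \<and> m * \<gamma> + q = (\<Sum>(\<phi>, \<xi>)\<leftarrow>ar. \<xi> i)"
proof (induction ar rule: rev_induct)
  case Nil
  show ?case using assms by (intro exI[of _ 0]) simp
next
  case (snoc p ar)
  obtain \<phi> \<xi> where p: "p = (\<phi>, \<xi>)" by force
  from snoc obtain m q where *: "fold (\<lambda>(\<phi>, \<xi>). add_unit \<gamma> ^^ \<xi> i) ar ([c], 0) = (c # replicate m \<gamma>, q)"
      "q < \<gamma>" "m * \<gamma> + q = (\<Sum>(\<phi>, \<xi>)\<leftarrow>ar. \<xi> i)" by blast
  obtain m' q' where **: "(add_unit \<gamma> ^^ \<xi> i) (c # replicate m \<gamma>, q) = ((c # replicate m \<gamma>) @ replicate m' \<gamma>, q')"
      "q' < \<gamma>" "m' * \<gamma> + q' = q + \<xi> i"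
    using add_unit_pow[OF assms *(2)] by blast
  have "(m + m') * \<gamma> + q' = (\<Sum>(\<phi>, \<xi>)\<leftarrow>ar @ [p]. \<xi> i)"
    using *(3) **(3) by (simp add: p add_mult_distrib)
  then show ?case
    using * ** by (intro exI[of _ "m + m'"] exI[of _ q']) (simp add: p replicate_add)
qed

lemma length_ready_batches_mono:
  assumes "1 \<le> \<gamma>"
  shows "length (ready_batches \<gamma> P ar i) \<le> length (ready_batches \<gamma> P (ar @ ar') i)"
proof (induction ar' rule: rev_induct)
  case (snoc p ar')
  obtain \<phi> \<xi> where p: "p = (\<phi>, \<xi>)" by force
  obtain bs q where *: "fold (\<lambda>(\<phi>, \<xi>). add_unit \<gamma> ^^ \<xi> i) (ar @ ar') ([init P i], 0) = (bs, q)" "q < \<gamma>"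
    using fold_add_unit[OF assms, of i "ar @ ar'" "init P i"] by blast
  obtain m' q' where "(add_unit \<gamma> ^^ \<xi> i) (bs, q) = (bs @ replicate m' \<gamma>, q')"
    using add_unit_pow[OF assms *(2)] by blast
  then have "length (ready_batches \<gamma> P (ar @ ar') i) \<le> length (ready_batches \<gamma> P (ar @ ar' @ [p]) i)"
    using * by (simp add: ready_batches_def p)
  with snoc show ?case by simp
qed simp

text \<open>Apart from the new sale no unit leaves, but some may return, hence an
  inequality.\<close>

lemma in_use_snoc_le:
  "in_use d (L @ [c]) x \<le> in_use d L x + (if c = Some x then 1 else 0)"
proof -
  let ?U = "{k. k < length L \<and> L ! k = Some x \<and> enat (length L) < enat k + d}"
  have less: "enat (length L) < enat k + d" if "enat (Suc (length L)) < enat k + d" for k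
    using that by (cases d) auto
  have "in_use d (L @ [c]) x \<le> card (?U \<union> (if c = Some x then {length L} else {}))"
    unfolding in_use_def
  proof (rule card_mono)
    show "{k. k < length (L @ [c]) \<and> (L @ [c]) ! k = Some x \<and> enat (length (L @ [c])) < enat k + d}
        \<subseteq> ?U \<union> (if c = Some x then {length L} else {})"
      using less by (auto simp: nth_append less_Suc_eq)
  qed auto
  also have "\<dots> \<le> card ?U + card (if c = Some x then {length L} else {})"
    by (rule card_Un_le)
  finally show ?thesis by (simp add: in_use_def split: if_splits)
qed

lemma length_bib_log [simp]: "length (bib_log \<gamma> br P arr h k) = k"
  by (induction k) (simp_all add: Let_def)

lemma bib_log_nth:
  "j < k \<Longrightarrow> bib_log \<gamma> br P arr h k ! j =
     map_option (\<lambda>i. (i, br P (take (Suc j) arr) (take j h) i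
       (best_batches \<gamma> P (take (Suc j) arr) (bib_log \<gamma> br P arr h j) i))) (snd (h ! j))"
  by (induction k) (auto simp: Let_def nth_append less_Suc_eq)

lemma take_bib_log: "j \<le> k \<Longrightarrow> take j (bib_log \<gamma> br P arr h k) = bib_log \<gamma> br P arr h j"
  by (induction k) (auto simp: Let_def le_Suc_eq)

lemma bib_log_take_arrivals: "k \<le> m \<Longrightarrow> bib_log \<gamma> br P (take m arr) h k = bib_log \<gamma> br P arr h k"
  by (induction k) (auto simp: Let_def min_def)

lemma bib_log_append: "k \<le> length h \<Longrightarrow> bib_log \<gamma> br P arr (h @ h') k = bib_log \<gamma> br P arr h k"
  by (induction k) (auto simp: Let_def nth_append)

text \<open>Feasibility rests on two properties of \<open>\<Psi>\<close>: nonnegative weights are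
  what the oracle accepts, and weight zero at level zero keeps exhausted products out. Both
  \<open>exp_penalty\<close> and every admissible penalty have them.\<close>

locale bib = input +
  fixes orc :: oracle_fun and br :: batch_rule and \<Psi> :: "real \<Rightarrow> real" and \<gamma> :: nat
  assumes exact: "exact_oracle orc" and batch_rule: "valid_batch_rule br" and \<gamma>: "1 \<le> \<gamma>"
    and \<Psi>_nonneg: "\<And>x. x \<in> {0..1} \<Longrightarrow> 0 \<le> \<Psi> x" and \<Psi>_0: "\<Psi> 0 = 0"
begin

abbreviation batches :: "nat \<Rightarrow> nat \<Rightarrow> nat" where
  "batches k i \<equiv> length (ready_batches \<gamma> P (take (Suc k) arr) i)"

text \<open>Independent of time, so that capacities can be stated for all batch numbers, whether the
  batch is ready yet or not.\<close>

definition batch_size :: "nat \<Rightarrow> nat \<Rightarrow> nat" where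
  "batch_size i j = (if j = 0 then init P i else \<gamma>)"

abbreviation log :: "history \<Rightarrow> nat \<Rightarrow> batch_log" where
  "log \<equiv> bib_log \<gamma> br P arr"

definition top_level :: "history \<Rightarrow> nat \<Rightarrow> nat \<Rightarrow> real" where
  "top_level h k i = max_level \<gamma> P (take (Suc k) arr) (log h k) i"

abbreviation policy :: policy where
  "policy \<equiv> run (BIB orc br \<Psi> \<gamma>) P arr"

definition offer :: "history \<Rightarrow> nat set" where
  "offer h = orc P (take (Suc (length h)) arr) (\<lambda>i. price P i * \<Psi> (top_level h (length h) i))"

lemma policy_eq: "policy h = return_pmf (offer h)"
  by (simp add: run_def BIB_def offer_def top_level_def bib_log_take_arrivals)

lemma top_level_append: "k \<le> length h \<Longrightarrow> top_level (h @ h') k = top_level h k"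
  by (simp add: top_level_def bib_log_append fun_eq_iff)

lemma top_level_take: "k \<le> length h \<Longrightarrow> top_level (take k h) k = top_level h k"
  using top_level_append[of k "take k h" "drop k h"] by simp

lemma ready_batches:
  obtains m q where "ready_batches \<gamma> P ar i = init P i # replicate m \<gamma>" "q < \<gamma>"
    "m * \<gamma> + q = (\<Sum>(\<phi>, \<xi>)\<leftarrow>ar. \<xi> i)"
  using fold_add_unit[OF \<gamma>, of i ar "init P i"] by (auto simp: ready_batches_def)

lemma ready_batches_nth: "j < length (ready_batches \<gamma> P ar i) \<Longrightarrow> ready_batches \<gamma> P ar i ! j = batch_size i j"
  by (rule ready_batches[of ar i]) (auto simp: batch_size_def nth_Cons')

lemma batches_pos: "0 < batches k i"
  by (rule ready_batches[of "take (Suc k) arr" i]) auto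

lemma batches_mono: "k \<le> k' \<Longrightarrow> batches k i \<le> batches k' i"
  using length_ready_batches_mono[OF \<gamma>, of P "take (Suc k) arr" i "take (k' - k) (drop (Suc k) arr)"]
  by (simp flip: take_add)

text \<open>The gap is the charging batch, with fewer than \<open>\<gamma>\<close> units. The first
  bound serves the feasibility of BIB, the second limits how much more stock the clairvoyant can
  use.\<close>

lemma sum_batch_size:
  fixes k i
  defines "stock \<equiv> init P i + (\<Sum>(\<phi>, \<xi>)\<leftarrow>take (Suc k) arr. \<xi> i)"
  shows "(\<Sum>j<batches k i. batch_size i j) \<le> stock" "stock < (\<Sum>j<batches k i. batch_size i j) + \<gamma>"
proof -
  obtain m q where *: "ready_batches \<gamma> P (take (Suc k) arr) i = init P i # replicate m \<gamma>" "q < \<gamma>"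
      "m * \<gamma> + q = (\<Sum>(\<phi>, \<xi>)\<leftarrow>take (Suc k) arr. \<xi> i)"
    by (rule ready_batches)
  have "(\<Sum>j<Suc m. batch_size i j) = init P i + m * \<gamma>"
    unfolding sum.lessThan_Suc_shift by (simp add: batch_size_def)
  then have "(\<Sum>j<batches k i. batch_size i j) = init P i + m * \<gamma>"
    by (simp add: *(1) del: sum.lessThan_Suc)
  then show "(\<Sum>j<batches k i. batch_size i j) \<le> stock" "stock < (\<Sum>j<batches k i. batch_size i j) + \<gamma>"
    using *(2,3) by (auto simp: stock_def)
qed

lemma batch_size_pos: "i \<in> items P \<Longrightarrow> 0 < batch_size i j"
  using init_pos \<gamma> by (simp add: batch_size_def)

lemma level_eq:
  "j < batches k i \<Longrightarrow>
     level \<gamma> P (take (Suc k) arr) L i j = 1 - in_use (dur P i) L (i, j) / batch_size i j"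
  by (simp add: level_def ready_batches_nth)

lemma top_level_ge:
  "j < batches k i \<Longrightarrow> 1 - in_use (dur P i) (log h k) (i, j) / batch_size i j \<le> top_level h k i"
  unfolding top_level_def max_level_def by (subst level_eq[symmetric]) auto

lemma best_batches_iff:
  "j \<in> best_batches \<gamma> P (take (Suc k) arr) (log h k) i \<longleftrightarrow>
     j < batches k i \<and> 1 - in_use (dur P i) (log h k) (i, j) / batch_size i j = top_level h k i"
proof -
  let ?l = "level \<gamma> P (take (Suc k) arr) (log h k) i"
  have "is_arg_max ?l (\<lambda>j. j < batches k i) j \<longleftrightarrow> j < batches k i \<and> ?l j = Max (?l ` {..<batches k i})"
    using batches_pos[of k i] unfolding is_arg_max_linorder
    by (auto intro!: Max_eqI[symmetric] simp: Max_ge_iff)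
  then show ?thesis
    unfolding best_batches_def top_level_def max_level_def by (auto simp: level_eq)
qed

lemma best_batch_exists: "best_batches \<gamma> P (take (Suc k) arr) (log h k) i \<noteq> {}"
proof -
  have "top_level h k i \<in> level \<gamma> P (take (Suc k) arr) (log h k) i ` {..<batches k i}"
    unfolding top_level_def max_level_def using batches_pos[of k i] by (intro Max_in) auto
  then show ?thesis
    using best_batches_iff by (force simp: level_eq)
qed

lemma log_SomeD:
  assumes "j < k" "log h k ! j = Some (i, b)"
  shows "snd (h ! j) = Some i" "b < batches j i"
    "top_level h j i = 1 - in_use (dur P i) (log h j) (i, b) / batch_size i b"
proof -
  from assms obtain h' ar where "snd (h ! j) = Some i"
      and b: "b = br P ar h' i (best_batches \<gamma> P (take (Suc j) arr) (log h j) i)"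
    by (auto simp: bib_log_nth)
  moreover have "b \<in> best_batches \<gamma> P (take (Suc j) arr) (log h j) i"
    unfolding b using batch_rule best_batch_exists by (simp add: valid_batch_rule_def)
  ultimately show "snd (h ! j) = Some i" "b < batches j i"
    "top_level h j i = 1 - in_use (dur P i) (log h j) (i, b) / batch_size i b"
    by (simp_all add: best_batches_iff)
qed

lemma log_Some:
  assumes "j < k" "snd (h ! j) = Some i"
  obtains b where "log h k ! j = Some (i, b)"
  using assms by (simp add: bib_log_nth)

text \<open>The invariant of a run: it keeps the top levels in \<open>{0..1}\<close>, where the
  penalty is nonnegative and the oracle therefore applies.\<close>

definition within_capacity :: "history \<Rightarrow> nat \<Rightarrow> bool" where
  "within_capacity h k \<longleftrightarrow> (\<forall>i\<in>items P. \<forall>b. in_use (dur P i) (log h k) (i, b) \<le> batch_size i b)"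

lemma top_level_range:
  assumes "within_capacity h k" "i \<in> items P"
  shows "top_level h k i \<in> {0..1}"
proof -
  obtain b where "b \<in> best_batches \<gamma> P (take (Suc k) arr) (log h k) i"
    using best_batch_exists by blast
  then have "top_level h k i = 1 - in_use (dur P i) (log h k) (i, b) / batch_size i b"
    by (simp add: best_batches_iff)
  moreover have "real (in_use (dur P i) (log h k) (i, b)) \<le> batch_size i b"
    using assms by (simp add: within_capacity_def)
  ultimately show ?thesis
    using batch_size_pos[OF assms(2), of b] by simp
qed

text \<open>The third claim is the use of smallest cardinality: a product of level zero has weight
  zero, and by weak substitutability its removal does not lower the objective, so it would leave a
  smaller maximiser.\<close>

lemma offer:
  assumes k: "length h < length arr" and cap: "within_capacity h (length h)"
  defines "R \<equiv> \<lambda>i. price P i * \<Psi> (top_level h (length h) i)"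
  shows "offer h \<in> assorts P"
    and "\<And>S. S \<in> assorts P \<Longrightarrow>
      (\<Sum>i\<in>items P. R i * fst (arr ! length h) S i) \<le> (\<Sum>i\<in>items P. R i * fst (arr ! length h) (offer h) i)"
    and "\<And>i. i \<in> offer h \<Longrightarrow> top_level h (length h) i \<noteq> 0"
proof -
  let ?ar = "take (Suc (length h)) arr" and ?\<phi> = "fst (arr ! length h)" and ?S = "offer h"
  have "valid_arrivals P ?ar"
    using arrivals by (auto simp: valid_arrivals_def dest!: in_set_takeD)
  moreover have "?ar \<noteq> []" using k by auto
  moreover have "last ?ar = arr ! length h"
    using k by (simp add: take_Suc_conv_app_nth)
  moreover have R: "0 \<le> R i" if "i \<in> items P" for i
    unfolding R_def using that top_level_range[OF cap that] by (intro mult_nonneg_nonneg price_nonneg \<Psi>_nonneg)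
  ultimately have "is_arg_min card
      (is_arg_max (\<lambda>S. \<Sum>i\<in>items P. R i * ?\<phi> S i) (\<lambda>S. S \<in> assorts P)) ?S"
    using exact[unfolded exact_oracle_def, rule_format, of P ?ar R] products
    unfolding offer_def R_def by simp
  then have max: "is_arg_max (\<lambda>S. \<Sum>i\<in>items P. R i * ?\<phi> S i) (\<lambda>S. S \<in> assorts P) ?S"
      and min: "\<And>S. is_arg_max (\<lambda>S. \<Sum>i\<in>items P. R i * ?\<phi> S i) (\<lambda>S. S \<in> assorts P) S \<Longrightarrow> card ?S \<le> card S"
    by (auto simp: is_arg_min_def not_less)
  from max show S: "?S \<in> assorts P"
    and opt: "\<And>S. S \<in> assorts P \<Longrightarrow> (\<Sum>i\<in>items P. R i * ?\<phi> S i) \<le> (\<Sum>i\<in>items P. R i * ?\<phi> ?S i)"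
    unfolding is_arg_max_linorder by auto
  show "top_level h (length h) i \<noteq> 0" if i: "i \<in> ?S" for i
  proof
    assume "top_level h (length h) i = 0"
    then have Ri: "R i = 0" by (simp add: R_def \<Psi>_0)
    let ?S' = "?S - {i}"
    have S': "?S' \<in> assorts P" using S by (rule assorts_downward) auto
    have sub: "?S \<subseteq> items P" using S by (rule assorts_subset)
    have "R x * ?\<phi> ?S x \<le> R x * ?\<phi> ?S' x" if x: "x \<in> items P" for x
    proof (cases "x = i")
      case False
      have ins: "insert i ?S' = ?S" using i by blast
      have "weakly_substitutable P ?\<phi>"
        using choice_valid[OF k] by (simp add: valid_choice_def)
      then have "i \<noteq> x \<and> insert i ?S' \<in> assorts P \<longrightarrow> ?\<phi> (insert i ?S') x \<le> ?\<phi> ?S' x"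
        using x i sub S' unfolding weakly_substitutable_def by blast
      then have "?\<phi> ?S x \<le> ?\<phi> ?S' x"
        using S False unfolding ins by simp
      then show ?thesis using R[OF x] by (rule mult_left_mono)
    qed (simp add: Ri)
    then have "(\<Sum>i\<in>items P. R i * ?\<phi> ?S i) \<le> (\<Sum>i\<in>items P. R i * ?\<phi> ?S' i)"
      by (intro sum_mono)
    then have "is_arg_max (\<lambda>S. \<Sum>i\<in>items P. R i * ?\<phi> S i) (\<lambda>S. S \<in> assorts P) ?S'"
      using S' opt unfolding is_arg_max_linorder by (blast intro: order_trans)
    then have "card ?S \<le> card ?S'" by (rule min)
    moreover have "card ?S' < card ?S"
      using i sub by (intro card_Diff1_less) (auto intro: finite_subset)
    ultimately show False by simp
  qed
qed

text \<open>The unit comes from a batch of top level, which is nonzero for an offered product, so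
  this batch was not fully in use.\<close>

lemma within_capacity_step:
  assumes k: "length h < length arr" and cap: "within_capacity h (length h)"
    and c: "c \<in> set_pmf (choice_pmf P (fst (arr ! length h)) (offer h))"
  shows "within_capacity (h @ [(S, c)]) (Suc (length h))"
  unfolding within_capacity_def
proof (intro ballI allI)
  let ?h = "h @ [(S, c)]" and ?k = "length h"
  fix i b assume i: "i \<in> items P"
  define x where "x = log ?h (Suc ?k) ! ?k"
  have "log ?h (Suc ?k) = take ?k (log ?h (Suc ?k)) @ [x]"
    using take_Suc_conv_app_nth[of ?k "log ?h (Suc ?k)"] by (simp add: x_def del: bib_log.simps)
  also have "take ?k (log ?h (Suc ?k)) = log h ?k"
    by (simp add: take_bib_log bib_log_append del: bib_log.simps)
  finally have log: "log ?h (Suc ?k) = log h ?k @ [x]" .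
  have le: "in_use (dur P i) (log h ?k) (i, b) \<le> batch_size i b"
    using cap i by (simp add: within_capacity_def)
  show "in_use (dur P i) (log ?h (Suc ?k)) (i, b) \<le> batch_size i b"
  proof (cases "x = Some (i, b)")
    case True
    then have "log ?h (Suc ?k) ! ?k = Some (i, b)" by (simp add: x_def)
    note * = log_SomeD[OF lessI this]
    have "c = Some i" using *(1) by simp
    then have "top_level h ?k i \<noteq> 0"
      using c by (intro offer(3)[OF k cap] Some_in_set_choice(2)[OF k offer(1)[OF k cap]]) simp
    with *(3) have "in_use (dur P i) (log h ?k) (i, b) \<noteq> batch_size i b"
      using batch_size_pos[OF i, of b] by (auto simp: top_level_append bib_log_append)
    with le show ?thesis
      using in_use_snoc_le[of "dur P i" "log h ?k" x "(i, b)"] True by (simp add: log del: bib_log.simps)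
  next
    case False
    with le show ?thesis
      using in_use_snoc_le[of "dur P i" "log h ?k" x "(i, b)"] by (simp add: log del: bib_log.simps)
  qed
qed

lemma history_within_capacity:
  "h \<in> set_pmf (history_pmf P arr policy k) \<Longrightarrow> k \<le> length arr \<Longrightarrow> within_capacity h k"
proof (induction k arbitrary: h)
  case 0
  then show ?case by (simp add: within_capacity_def in_use_def)
next
  case (Suc k)
  then obtain h' c where h: "h = h' @ [(offer h', c)]" "h' \<in> set_pmf (history_pmf P arr policy k)"
      and c: "c \<in> set_pmf (choice_pmf P (fst (arr ! k)) (offer h'))"
    unfolding set_history_pmf_Suc policy_eq by auto
  have k: "length h' = k" using h(2) by (rule length_history)
  show ?case
    using within_capacity_step[of h' c "offer h'"] Suc h(2) c unfolding h(1) k by simp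
qed

lemma in_use_history:
  assumes "length h = k"
  shows "in_use d (map snd h) i = (\<Sum>b<batches k i. in_use d (log h k) (i, b))"
proof -
  let ?U = "\<lambda>b. {t. t < k \<and> log h k ! t = Some (i, b) \<and> enat k < enat t + d}"
  have "{t. t < k \<and> snd (h ! t) = Some i \<and> enat k < enat t + d} = (\<Union>b<batches k i. ?U b)"
  proof (intro set_eqI iffI)
    fix t assume t: "t \<in> {t. t < k \<and> snd (h ! t) = Some i \<and> enat k < enat t + d}"
    then obtain b where "log h k ! t = Some (i, b)" by (auto elim: log_Some)
    with t show "t \<in> (\<Union>b<batches k i. ?U b)"
      using log_SomeD(2)[of t k h i b] batches_mono[of t k i] by auto
  qed (auto dest: log_SomeD(1))
  moreover have "card (\<Union>b<batches k i. ?U b) = (\<Sum>b<batches k i. card (?U b))"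
    by (intro card_UN_disjoint) auto
  moreover have "in_use d (map snd h) i = card {t. t < k \<and> snd (h ! t) = Some i \<and> enat k < enat t + d}"
    unfolding in_use_def using assms by (intro arg_cong[of _ _ card]) auto
  ultimately show ?thesis
    by (simp add: in_use_def)
qed

text \<open>No batch is overfull and the best one has a free unit, so the units in use are fewer
  than those of the ready batches, which in turn are part of the stock.\<close>

lemma offer_feasible:
  assumes k: "length h < length arr" and cap: "within_capacity h (length h)"
  shows "offer h \<in> feasible_offers P arr h"
  unfolding feasible_offers_def
proof (intro CollectI conjI ballI)
  let ?k = "length h"
  show "offer h \<in> assorts P" using assms by (rule offer)
  fix i assume i: "i \<in> offer h"
  then have item: "i \<in> items P"
    using assorts_subset[OF offer(1)[OF assms]] by blast
  have le: "in_use (dur P i) (log h ?k) (i, b) \<le> batch_size i b" for b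
    using cap item by (simp add: within_capacity_def)
  obtain b where b: "b < batches ?k i" "1 - in_use (dur P i) (log h ?k) (i, b) / batch_size i b = top_level h ?k i"
    using best_batch_exists[of ?k h i] by (auto simp: best_batches_iff)
  have "in_use (dur P i) (log h ?k) (i, b) \<noteq> batch_size i b"
    using b(2) offer(3)[OF assms i] batch_size_pos[OF item, of b] by auto
  with le[of b] have "in_use (dur P i) (log h ?k) (i, b) < batch_size i b" by simp
  then have "in_use (dur P i) (map snd h) i < (\<Sum>b<batches ?k i. batch_size i b)"
    unfolding in_use_history[OF refl] using le b(1) by (intro sum_strict_mono_ex1) auto
  also have "\<dots> \<le> init P i + (\<Sum>(\<phi>, \<xi>)\<leftarrow>take (Suc ?k) arr. \<xi> i)"
    by (rule sum_batch_size)
  finally show "in_stock P arr h i" by (simp add: in_stock_def)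
qed

lemma feasible_policy: "feasible_policy P arr policy"
  unfolding feasible_policy_def
proof (intro allI impI ballI)
  fix k h assume "k < length arr" and h: "h \<in> set_pmf (history_pmf P arr policy k)"
  then show "set_pmf (policy h) \<subseteq> feasible_offers P arr h"
    using history_within_capacity[OF h] length_history[OF h] offer_feasible by (simp add: policy_eq)
qed

sublocale bib: feasible P arr policy
  by unfold_locales (rule feasible_policy)

end

lemma online_algorithm_BIB:
  assumes "exact_oracle orc" "valid_batch_rule br" "1 \<le> \<gamma>"
    "\<And>x. x \<in> {0..1} \<Longrightarrow> 0 \<le> \<Psi> x" "\<Psi> 0 = 0"
  shows "online_algorithm (BIB orc br \<Psi> \<gamma>)"
  unfolding online_algorithm_def
proof (intro allI impI)
  fix P arr assume "valid_products P \<and> valid_arrivals P arr"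
  then interpret bib P arr orc br \<Psi> \<gamma>
    using assms by unfold_locales auto
  show "feasible_policy P arr (run (BIB orc br \<Psi> \<gamma>) P arr)" by (rule feasible_policy)
qed


section \<open>The lower bound for BIB\<close>

text \<open>The price of discreteness: the left side tends to 1 for large batches.\<close>

lemma exp_minus_one_bound:
  assumes "1 \<le> s"
  shows "real s * (exp (1 / s) - 1) \<le> 1 + 1 / s"
proof -
  have "exp (1 / real s) \<le> 1 + 1 / s + (1 / s)\<^sup>2"
    using assms by (intro exp_bound) auto
  then have "real s * (exp (1 / s) - 1) \<le> s * (1 / s + (1 / s)\<^sup>2)"
    by (intro mult_left_mono) auto
  also have "\<dots> = 1 + 1 / s"
    using assms by (simp add: field_simps power2_eq_square)
  finally show ?thesis .
qed

lemma (in feasible) sum_sale_by_item: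
  assumes h: "h \<in> set_pmf (history_pmf P arr \<pi> (length arr))"
  shows "(\<Sum>t<length arr. sale (f t) (snd (h ! t)))
           = (\<Sum>i\<in>items P. \<Sum>t | t < length arr \<and> snd (h ! t) = Some i. f t i)"
proof -
  have "sale (f t) (snd (h ! t)) = (\<Sum>i\<in>items P. if snd (h ! t) = Some i then f t i else 0)"
    if "t < length arr" for t
    using sold(1)[OF h order_refl that] by (cases "snd (h ! t)") auto
  then have "(\<Sum>t<length arr. sale (f t) (snd (h ! t)))
      = (\<Sum>t<length arr. \<Sum>i\<in>items P. if snd (h ! t) = Some i then f t i else 0)"
    by simp
  also have "\<dots> = (\<Sum>i\<in>items P. \<Sum>t<length arr. if snd (h ! t) = Some i then f t i else 0)"
    by (rule sum.swap)
  also have "\<dots> = (\<Sum>i\<in>items P. \<Sum>t | t \<in> {..<length arr} \<and> snd (h ! t) = Some i. f t i)"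
    by (simp only: sum.inter_filter finite_lessThan)
  finally show ?thesis by simp
qed

locale bib_exp = bib P arr orc br exp_penalty \<gamma>
  for P arr orc br \<gamma> +
  fixes c :: nat
  assumes \<gamma>_le: "\<gamma> \<le> c" and init_ge: "\<And>i. i \<in> items P \<Longrightarrow> c \<le> init P i"
begin

text \<open>The first factor pays for the charging batch, which BIB does not use, the second for the
  granularity of batches of size \<open>\<gamma>\<close>. The errors \<open>\<gamma> / c\<close> and
  \<open>1 / \<gamma>\<close> balance at \<open>sqrt c\<close>.\<close>

definition loss :: real where
  "loss = (1 + \<gamma> / c) * (1 + 1 / \<gamma>)"

lemma loss_ge_1: "1 \<le> loss"
proof -
  have "1 * 1 \<le> (1 + real \<gamma> / c) * (1 + 1 / \<gamma>)" by (intro mult_mono) auto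
  then show ?thesis by (simp add: loss_def)
qed

text \<open>The first batch also accounts for the units that still sit in the charging batch.\<close>

definition inflated :: "nat \<Rightarrow> nat \<Rightarrow> nat" where
  "inflated i b = batch_size i b + (if b = 0 then \<gamma> - 1 else 0)"

text \<open>The first batch has at least \<open>c\<close> units, so \<open>\<gamma> - 1\<close>
  additional ones enlarge it by a fraction of at most \<open>\<gamma> / c\<close>; a batch of size
  \<open>\<gamma>\<close> would almost double.\<close>

lemma inflated_bound:
  assumes "i \<in> items P"
  shows "real (inflated i b) * (exp (1 / batch_size i b) - 1) \<le> loss"
proof -
  define s where "s = batch_size i b"
  have s: "1 \<le> s" using batch_size_pos[OF assms, of b] by (simp add: s_def)
  have "\<gamma> \<le> s" using \<gamma>_le init_ge[OF assms] by (simp add: s_def batch_size_def)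
  have "real (inflated i b) \<le> (1 + \<gamma> / c) * s"
  proof (cases "b = 0")
    case True
    have "c \<le> s" using True init_ge[OF assms] by (simp add: s_def batch_size_def)
    moreover have "0 < c" using \<gamma> \<gamma>_le by simp
    ultimately have "real \<gamma> \<le> \<gamma> / c * s"
      by (simp add: field_simps mult_left_mono)
    then show ?thesis using True \<gamma> by (simp add: inflated_def s_def algebra_simps)
  next
    case False
    then show ?thesis by (simp add: inflated_def s_def algebra_simps)
  qed
  then have "real (inflated i b) * (exp (1 / s) - 1) \<le> (1 + \<gamma> / c) * s * (exp (1 / s) - 1)"
    by (rule mult_right_mono) simp
  also have "\<dots> = (1 + \<gamma> / c) * (s * (exp (1 / s) - 1))" by simp
  also have "\<dots> \<le> (1 + \<gamma> / c) * (1 + 1 / s)"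
    using exp_minus_one_bound[OF s] by (intro mult_left_mono) auto
  also have "\<dots> \<le> loss"
    unfolding loss_def using \<open>\<gamma> \<le> s\<close> \<gamma> by (intro mult_left_mono add_left_mono divide_left_mono) auto
  finally show ?thesis by (simp add: s_def)
qed

lemma in_use_log:
  assumes "t \<le> k"
  shows "in_use d (log h t) x = card (active d {a. a < k \<and> log h k ! a = Some x} t)"
proof -
  have "log h t ! a = log h k ! a" if "a < t" for a
    using that assms by (simp flip: take_bib_log[OF assms])
  then show ?thesis
    unfolding in_use_def active_def using assms by (intro arg_cong[of _ _ card]) auto
qed

text \<open>No probability is involved here: the sales on the clairvoyant path are placed into
  batches of inflated capacity, and each batch is compared with the sales of \<open>h\<close> from
  it by \<open>single_batch_bound\<close>.\<close>

lemma pathwise: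
  assumes \<pi>: "feasible_policy P arr \<pi>"
    and h': "h' \<in> set_pmf (history_pmf P arr \<pi> (length arr))"
    and i: "i \<in> items P"
  shows "(\<Sum>t | t < length arr \<and> snd (h' ! t) = Some i. exp (- top_level h t i) - exp (- 1))
           \<le> loss * (\<Sum>t | t < length arr \<and> snd (h ! t) = Some i. exp (- top_level h t i))"
proof -
  interpret opt: feasible P arr \<pi> using \<pi> by unfold_locales
  let ?T = "length arr" and ?d = "dur P i"
  let ?Q = "{t. t < ?T \<and> snd (h' ! t) = Some i}"
  let ?A = "\<lambda>b. {t. t < ?T \<and> log h ?T ! t = Some (i, b)}"
  let ?load = "\<lambda>b t. real (card (active ?d (?A b) t)) / batch_size i b"
  \<comment> \<open>The clairvoyant can draw on the whole stock, which exceeds the ready batches by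
    at most \<open>\<gamma> - 1\<close>, the amount added to batch 0.\<close>
  have "card (active ?d ?Q q) < (\<Sum>b<batches q i. inflated i b)" if q: "q \<in> ?Q" for q
  proof -
    have "card (active ?d ?Q q) = in_use ?d (map snd (take q h')) i"
      unfolding in_use_def active_def using q length_history[OF h']
      by (intro arg_cong[of _ _ card]) auto
    also have "\<dots> < init P i + (\<Sum>(\<phi>, \<xi>)\<leftarrow>take (Suc q) arr. \<xi> i)"
      using opt.sold(2)[OF h' order_refl, of q i] q length_history[OF h'] by (simp add: in_stock_def)
    also have "\<dots> \<le> (\<Sum>b<batches q i. batch_size i b) + (\<gamma> - 1)"
      using sum_batch_size(2)[of i q] by simp
    also have "\<dots> = (\<Sum>b<batches q i. inflated i b)"
      using batches_pos[of q i] by (simp add: inflated_def sum.distrib)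
    finally show ?thesis .
  qed
  then obtain \<beta> where \<beta>: "\<And>q. q \<in> ?Q \<Longrightarrow> \<beta> q < batches q i"
      "\<And>q. q \<in> ?Q \<Longrightarrow> card (active ?d {q'\<in>?Q. \<beta> q' = \<beta> q} q) < inflated i (\<beta> q)"
    using greedy_assignment[where Q = ?Q and d = ?d and n = "\<lambda>q. batches q i" and cap = "inflated i"] by auto
  let ?Qb = "\<lambda>b. {q\<in>?Q. \<beta> q = b}"
  let ?N = "batches ?T i"
  have batch: "(\<Sum>q\<in>?Qb b. exp (- top_level h q i) - exp (- 1))
      \<le> loss * (\<Sum>a\<in>?A b. exp (- top_level h a i))" for b
  proof -
    have "(\<Sum>q\<in>?Qb b. exp (- top_level h q i) - exp (- 1)) \<le> (\<Sum>q\<in>?Qb b. exp (- 1) * (exp (?load b q) - 1))"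
    proof (rule sum_mono)
      fix q assume q: "q \<in> ?Qb b"
      \<comment> \<open>The batch assigned to \<open>q\<close> need not be the fullest, but the top
        level is at least its level, which is the direction wanted for an upper bound.\<close>
      then have "1 - ?load b q \<le> top_level h q i"
        using \<beta>(1)[of q] top_level_ge[of b q i h] by (auto simp: in_use_log[of q ?T])
      then have "exp (- top_level h q i) \<le> exp (?load b q + - 1)" by simp
      then show "exp (- top_level h q i) - exp (- 1) \<le> exp (- 1) * (exp (?load b q) - 1)"
        unfolding exp_add by (simp add: algebra_simps)
    qed
    also have "\<dots> = exp (- 1) * (\<Sum>q\<in>?Qb b. exp (?load b q) - 1)"
      by (simp only: sum_distrib_left)
    also have "(\<Sum>q\<in>?Qb b. exp (?load b q) - 1)
        \<le> real (inflated i b) * (exp (1 / batch_size i b) - 1) * (\<Sum>a\<in>?A b. exp (?load b a))"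
      using \<beta>(2) by (intro single_batch_bound batch_size_pos[OF i]) auto
    also have "\<dots> \<le> loss * (\<Sum>a\<in>?A b. exp (?load b a))"
      using inflated_bound[OF i] by (intro mult_right_mono sum_nonneg) auto
    also have "exp (- 1) * (loss * (\<Sum>a\<in>?A b. exp (?load b a))) = loss * (\<Sum>a\<in>?A b. exp (?load b a + - 1))"
      unfolding exp_add by (simp add: sum_distrib_left sum_distrib_right mult_ac)
    also have "(\<Sum>a\<in>?A b. exp (?load b a + - 1)) = (\<Sum>a\<in>?A b. exp (- top_level h a i))"
    \<comment> \<open>BIB draws from a batch of maximal level, so for its own sales the level of the
      batch is the top level.\<close>
    proof (rule sum.cong[OF refl])
      fix a assume a: "a \<in> ?A b"
      then show "exp (?load b a + - 1) = exp (- top_level h a i)"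
        using log_SomeD(3)[of a ?T h i b] by (auto simp: in_use_log[of a ?T])
    qed
    finally show ?thesis by simp
  qed
  have sold_iff: "{t. t < ?T \<and> snd (h ! t) = Some i} = (\<Union>b<?N. ?A b)"
  proof (intro set_eqI iffI)
    fix t assume t: "t \<in> {t. t < ?T \<and> snd (h ! t) = Some i}"
    then obtain b where "log h ?T ! t = Some (i, b)" by (auto elim: log_Some)
    with t show "t \<in> (\<Union>b<?N. ?A b)"
      using log_SomeD(2)[of t ?T h i b] batches_mono[of t ?T i] by auto
  qed (auto dest: log_SomeD(1))
  have "\<beta> q < ?N" if "q \<in> ?Q" for q
    using \<beta>(1)[OF that] batches_mono[of q ?T i] that by simp
  then have "(\<Sum>q\<in>?Q. exp (- top_level h q i) - exp (- 1)) = (\<Sum>b<?N. \<Sum>q\<in>?Qb b. exp (- top_level h q i) - exp (- 1))"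
    by (intro sum.group[symmetric]) auto
  also have "\<dots> \<le> (\<Sum>b<?N. loss * (\<Sum>a\<in>?A b. exp (- top_level h a i)))"
    by (intro sum_mono batch)
  also have "\<dots> = loss * (\<Sum>b<?N. \<Sum>a\<in>?A b. exp (- top_level h a i))"
    by (simp only: sum_distrib_left)
  also have "(\<Sum>b<?N. \<Sum>a\<in>?A b. exp (- top_level h a i)) = (\<Sum>a\<in>(\<Union>b<?N. ?A b). exp (- top_level h a i))"
    by (intro sum.UNION_disjoint[symmetric]) auto
  finally show ?thesis unfolding sold_iff .
qed

section \<open>Comparison with an independent clairvoyant run\<close>

definition reward :: "history \<Rightarrow> nat \<Rightarrow> nat \<Rightarrow> real" where
  "reward h t i = price P i * (1 - exp (- top_level h t i))"

lemma reward_append: "t \<le> length h \<Longrightarrow> reward (h @ h') t = reward h t"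
  by (simp add: reward_def top_level_append fun_eq_iff)

lemma offer_maximizes_reward:
  assumes "length h < length arr" "within_capacity h (length h)" "S \<in> assorts P"
  shows "(\<Sum>i\<in>items P. reward h (length h) i * fst (arr ! length h) S i)
           \<le> (\<Sum>i\<in>items P. reward h (length h) i * fst (arr ! length h) (offer h) i)"
proof -
  have e: "exp 1 > (1 :: real)" by simp
  have scale: "reward h t i = (1 - exp (- 1)) * (price P i * exp_penalty (top_level h t i))" for t i
  proof -
    have "exp_penalty x = (1 - exp (- x)) / (1 - exp (- 1))" for x
      using e by (simp add: exp_penalty_def exp_diff exp_minus field_simps)
    then show ?thesis by (simp add: reward_def)
  qed
  have "(1 - exp (- 1)) * (\<Sum>i\<in>items P. price P i * exp_penalty (top_level h (length h) i) * fst (arr ! length h) S i)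
    \<le> (1 - exp (- 1)) * (\<Sum>i\<in>items P. price P i * exp_penalty (top_level h (length h) i) * fst (arr ! length h) (offer h) i)"
    using offer(2)[OF assms] by (intro mult_left_mono) auto
  then show ?thesis
    by (simp add: scale sum_distrib_left mult.assoc)
qed

text \<open>\<open>h\<close> and \<open>h'\<close> are drawn independently, and the rewards of
  period \<open>k\<close> depend only on the first \<open>k\<close> entries of \<open>h\<close>.
  Given both pasts, the expected reward of the clairvoyant's offer is at most that of
  \<open>offer h\<close>, which is just what BIB earns in that period.\<close>

lemma reward_comparison:
  assumes \<pi>: "feasible_policy P arr \<pi>" and "k \<le> length arr"
  shows "measure_pmf.expectation (history_pmf P arr policy k)
      (\<lambda>h. measure_pmf.expectation (history_pmf P arr \<pi> k) (\<lambda>h'. \<Sum>t<k. sale (reward h t) (snd (h' ! t))))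
    \<le> measure_pmf.expectation (history_pmf P arr policy k) (\<lambda>h. \<Sum>t<k. sale (reward h t) (snd (h ! t)))"
  using assms(2)
proof (induction k)
  case (Suc k)
  interpret opt: feasible P arr \<pi> using \<pi> by unfold_locales
  let ?p = "history_pmf P arr policy" and ?q = "history_pmf P arr \<pi>" and ?\<phi> = "fst (arr ! k)"
  let ?M = "\<lambda>k h h'. \<Sum>t<k. sale (reward h t) (snd (h' ! t))"
  let ?w = "\<lambda>h S. \<Sum>i\<in>items P. reward h k i * ?\<phi> S i"
  have k: "k < length arr" using Suc.prems by simp
  note fin = bib.finite_history opt.finite_history
  have M_snoc: "?M (Suc k) (h @ x) (h' @ [(S, c)]) = ?M k h h' + sale (reward h k) c"
    if "length h = k" "length h' = k" for h h' x S c
    using that by (simp add: reward_append nth_append)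
  have M_left: "?M (Suc k) h h' = ?M (Suc k) (take k h) h'" if "length h = Suc k" for h h'
    using that reward_append[of _ "take k h" "drop k h"] by simp
  have opt_step: "measure_pmf.expectation (?q (Suc k)) (?M (Suc k) h)
      \<le> measure_pmf.expectation (?q k) (?M k h) + ?w h (offer h)"
    if h: "h \<in> set_pmf (?p k)" for h
  proof -
    have len: "length h = k" using h by (rule length_history)
    have cap: "within_capacity h k" using h k by (intro history_within_capacity) auto
    have "measure_pmf.expectation (?q (Suc k)) (?M (Suc k) h)
        = measure_pmf.expectation (?q k) (\<lambda>h'. measure_pmf.expectation (\<pi> h') (\<lambda>S.
            measure_pmf.expectation (choice_pmf P ?\<phi> S) (\<lambda>c. ?M (Suc k) h (h' @ [(S, c)]))))"
      by (rule opt.expectation_history_Suc[OF k])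
    also have "\<dots> \<le> measure_pmf.expectation (?q k) (\<lambda>h'. ?M k h h' + ?w h (offer h))"
    proof (rule expectation_mono_finite)
      fix h' assume h': "h' \<in> set_pmf (?q k)"
      have "measure_pmf.expectation (\<pi> h') (\<lambda>S.
            measure_pmf.expectation (choice_pmf P ?\<phi> S) (\<lambda>c. ?M (Suc k) h (h' @ [(S, c)])))
          \<le> measure_pmf.expectation (\<pi> h') (\<lambda>S. ?M k h h' + ?w h (offer h))"
      proof (rule expectation_mono_finite)
        fix S assume S: "S \<in> set_pmf (\<pi> h')"
        have S': "S \<in> assorts P" using opt.offers_assorts[OF k h' S] .
        have "measure_pmf.expectation (choice_pmf P ?\<phi> S) (\<lambda>c. ?M (Suc k) h (h' @ [(S, c)]))
            = measure_pmf.expectation (choice_pmf P ?\<phi> S) (\<lambda>c. ?M k h h' + sale (reward h k) c)"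
          using M_snoc[of h h' "[]" S] len length_history[OF h'] by simp
        also have "\<dots> = ?M k h h' + ?w h S"
          by (rule expectation_choice[OF k S'])
        also have "\<dots> \<le> ?M k h h' + ?w h (offer h)"
          using offer_maximizes_reward[of h S] k cap S' by (simp add: len)
        finally show "measure_pmf.expectation (choice_pmf P ?\<phi> S) (\<lambda>c. ?M (Suc k) h (h' @ [(S, c)]))
            \<le> ?M k h h' + ?w h (offer h)" .
      qed (rule opt.finite_offers[OF k h'])
      then show "measure_pmf.expectation (\<pi> h') (\<lambda>S.
            measure_pmf.expectation (choice_pmf P ?\<phi> S) (\<lambda>c. ?M (Suc k) h (h' @ [(S, c)])))
          \<le> ?M k h h' + ?w h (offer h)" by simp
    qed (use k in \<open>simp add: fin\<close>)
    also have "\<dots> = measure_pmf.expectation (?q k) (?M k h) + ?w h (offer h)"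
      using k by (simp add: integrable_measure_pmf_finite fin)
    finally show ?thesis .
  qed
  \<comment> \<open>Rewards up to period \<open>k\<close> are fixed before BIB's choice in period
    \<open>k\<close>, so that choice can be integrated out.\<close>
  have "measure_pmf.expectation (?p (Suc k)) (\<lambda>h. measure_pmf.expectation (?q (Suc k)) (?M (Suc k) h))
      = measure_pmf.expectation (?p (Suc k)) (\<lambda>h. measure_pmf.expectation (?q (Suc k)) (?M (Suc k) (take k h)))"
    by (intro expectation_cong_pmf Bochner_Integration.integral_cong refl M_left length_history)
  also have "\<dots> = measure_pmf.expectation (map_pmf (take k) (?p (Suc k))) (\<lambda>h. measure_pmf.expectation (?q (Suc k)) (?M (Suc k) h))"
    by (simp only: integral_map_pmf)
  also have "map_pmf (take k) (?p (Suc k)) = ?p k"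
    using map_take_history_pmf[of k P arr policy 1] by simp
  also have "measure_pmf.expectation (?p k) (\<lambda>h. measure_pmf.expectation (?q (Suc k)) (?M (Suc k) h))
      \<le> measure_pmf.expectation (?p k) (\<lambda>h. measure_pmf.expectation (?q k) (?M k h) + ?w h (offer h))"
    using k by (intro expectation_mono_finite opt_step fin) auto
  also have "\<dots> = measure_pmf.expectation (?p k) (\<lambda>h. measure_pmf.expectation (?q k) (?M k h))
      + measure_pmf.expectation (?p k) (\<lambda>h. ?w h (offer h))"
    using k by (intro Bochner_Integration.integral_add integrable_measure_pmf_finite fin) auto
  also have "\<dots> \<le> measure_pmf.expectation (?p k) (\<lambda>h. ?M k h h)
      + measure_pmf.expectation (?p k) (\<lambda>h. ?w h (offer h))"
    using Suc by simp
  also have "\<dots> = measure_pmf.expectation (?p k) (\<lambda>h. ?M k h h + ?w h (offer h))"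
    using k by (intro Bochner_Integration.integral_add[symmetric] integrable_measure_pmf_finite fin) auto
  also have "\<dots> = measure_pmf.expectation (?p k) (\<lambda>h. measure_pmf.expectation (policy h) (\<lambda>S.
            measure_pmf.expectation (choice_pmf P ?\<phi> S) (\<lambda>c. ?M (Suc k) (h @ [(S, c)]) (h @ [(S, c)]))))"
  proof (rule expectation_cong_pmf)
    fix h assume h: "h \<in> set_pmf (?p k)"
    have len: "length h = k" using h by (rule length_history)
    have "within_capacity h k" using h k by (intro history_within_capacity) auto
    then have "offer h \<in> assorts P" using k by (intro offer(1)) (auto simp: len)
    then show "?M k h h + ?w h (offer h) = measure_pmf.expectation (policy h) (\<lambda>S.
            measure_pmf.expectation (choice_pmf P ?\<phi> S) (\<lambda>c. ?M (Suc k) (h @ [(S, c)]) (h @ [(S, c)])))"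
      unfolding policy_eq M_snoc[OF len len] by (simp add: expectation_choice[OF k])
  qed
  also have "\<dots> = measure_pmf.expectation (?p (Suc k)) (\<lambda>h. ?M (Suc k) h h)"
    by (rule bib.expectation_history_Suc[OF k, symmetric])
  finally show ?case .
qed simp

text \<open>\<open>?M\<close> and \<open>?D\<close> split a revenue into rewards and rests.
  Pathwise, \<open>(1 - 1/e)\<close> times the clairvoyant revenue is at most
  \<open>?M h h' + loss * ?D h h\<close>; in expectation \<open>?M h h\<close> replaces
  \<open>?M h h'\<close>.\<close>

lemma BIB_competitive:
  assumes \<pi>: "feasible_policy P arr \<pi>"
  shows "(1 - exp (- 1)) * expected_revenue P arr \<pi> \<le> loss * expected_revenue P arr policy"
proof -
  interpret opt: feasible P arr \<pi> using \<pi> by unfold_locales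
  let ?T = "length arr"
  let ?p = "history_pmf P arr policy ?T" and ?q = "history_pmf P arr \<pi> ?T"
  let ?M = "\<lambda>h h'. \<Sum>t<?T. sale (reward h t) (snd (h' ! t))"
  let ?D = "\<lambda>h h'. \<Sum>t<?T. sale (\<lambda>i. price P i * exp (- top_level h t i)) (snd (h' ! t))"
  have fin: "finite (set_pmf ?p)" "finite (set_pmf ?q)"
    by (simp_all add: bib.finite_history opt.finite_history)
  note int = integrable_measure_pmf_finite[OF fin(1)] integrable_measure_pmf_finite[OF fin(2)]
  have rev: "?M h h' + ?D h h' = revenue P h'" if "length h' = ?T" for h h'
    unfolding opt.revenue_sale that sum.distrib[symmetric]
    by (intro sum.cong refl) (auto simp: reward_def sale_def algebra_simps split: option.split)
  have "(1 - exp (- 1)) * revenue P h' \<le> ?M h h' + loss * ?D h h"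
    if h: "h \<in> set_pmf ?p" and h': "h' \<in> set_pmf ?q" for h h'
  proof -
    have "?D h h' - exp (- 1) * revenue P h'
        = (\<Sum>t<?T. sale (\<lambda>i. price P i * (exp (- top_level h t i) - exp (- 1))) (snd (h' ! t)))"
      unfolding opt.revenue_sale length_history[OF h'] sum_distrib_left sum_subtractf[symmetric]
      by (intro sum.cong refl) (auto simp: sale_def algebra_simps split: option.split)
    also have "\<dots> = (\<Sum>i\<in>items P. price P i * (\<Sum>t | t < ?T \<and> snd (h' ! t) = Some i. exp (- top_level h t i) - exp (- 1)))"
      unfolding opt.sum_sale_by_item[OF h'] by (simp add: sum_distrib_left)
    also have "\<dots> \<le> (\<Sum>i\<in>items P. price P i * (loss * (\<Sum>t | t < ?T \<and> snd (h ! t) = Some i. exp (- top_level h t i))))"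
      by (intro sum_mono mult_left_mono pathwise[OF \<pi> h'] price_nonneg)
    also have "\<dots> = loss * ?D h h"
      unfolding bib.sum_sale_by_item[OF h] by (simp add: sum_distrib_left mult.left_commute)
    finally show ?thesis
      using rev[OF length_history[OF h'], of h] by (simp add: algebra_simps)
  qed
  then have "measure_pmf.expectation ?q (\<lambda>h'. (1 - exp (- 1)) * revenue P h')
      \<le> measure_pmf.expectation ?q (\<lambda>h'. ?M h h' + loss * ?D h h)" if "h \<in> set_pmf ?p" for h
    using that by (intro expectation_mono_finite fin) auto
  then have "(1 - exp (- 1)) * expected_revenue P arr \<pi> \<le> measure_pmf.expectation ?q (?M h) + loss * ?D h h"
    if "h \<in> set_pmf ?p" for h
    using that by (simp add: expected_revenue_def int)
  then have "measure_pmf.expectation ?p (\<lambda>_. (1 - exp (- 1)) * expected_revenue P arr \<pi>)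
      \<le> measure_pmf.expectation ?p (\<lambda>h. measure_pmf.expectation ?q (?M h) + loss * ?D h h)"
    by (intro expectation_mono_finite fin) auto
  also have "\<dots> = measure_pmf.expectation ?p (\<lambda>h. measure_pmf.expectation ?q (?M h))
      + measure_pmf.expectation ?p (\<lambda>h. loss * ?D h h)"
    by (intro Bochner_Integration.integral_add int)
  also have "\<dots> \<le> measure_pmf.expectation ?p (\<lambda>h. ?M h h) + measure_pmf.expectation ?p (\<lambda>h. loss * ?D h h)"
    using reward_comparison[OF \<pi> order_refl] by simp
  also have "\<dots> = measure_pmf.expectation ?p (\<lambda>h. ?M h h + loss * ?D h h)"
    by (intro Bochner_Integration.integral_add[symmetric] int)
  \<comment> \<open>Levels along a run of BIB are nonnegative, hence so are its rewards; they may be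
    multiplied by \<open>loss \<ge> 1\<close> as well, and the two parts recombine to the
    revenue.\<close>
  also have "\<dots> \<le> measure_pmf.expectation ?p (\<lambda>h. loss * revenue P h)"
  proof (intro expectation_mono_finite fin)
    fix h assume h: "h \<in> set_pmf ?p"
    have "0 \<le> reward h t i" if "t < ?T" "snd (h ! t) = Some i" for t i
    proof -
      have item: "i \<in> items P" using bib.sold(1)[OF h order_refl that] .
      have "within_capacity (take t h) t"
        using h that by (intro history_within_capacity take_history) auto
      then have "0 \<le> top_level h t i"
        using top_level_range[of "take t h" t i] item that length_history[OF h] by (simp add: top_level_take)
      then show ?thesis using price_nonneg[OF item] by (simp add: reward_def)
    qed
    then have "0 \<le> ?M h h"
      by (intro sum_nonneg) (auto simp: sale_def split: option.split)
    then have "?M h h \<le> loss * ?M h h"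
      using loss_ge_1 mult_right_mono[of 1 loss "?M h h"] by simp
    moreover have "loss * revenue P h = loss * ?M h h + loss * ?D h h"
      by (simp only: rev[OF length_history[OF h], of h, symmetric] distrib_left)
    ultimately show "?M h h + loss * ?D h h \<le> loss * revenue P h"
      by simp
  qed
  finally show ?thesis by (simp add: expected_revenue_def)
qed

end

lemma exp_penalty_nonneg: "x \<in> {0..1} \<Longrightarrow> 0 \<le> exp_penalty x"
  unfolding exp_penalty_def by (intro divide_nonpos_nonpos) auto

lemma exp_penalty_0: "exp_penalty 0 = 0"
  by (simp add: exp_penalty_def)

lemma CR_BIB_ge:
  assumes "exact_oracle orc" "valid_batch_rule br" "1 \<le> \<gamma>" "\<gamma> \<le> c"
  shows "ereal ((1 - 1 / exp 1) / ((1 + \<gamma> / c) * (1 + 1 / \<gamma>))) \<le> CR (BIB orc br exp_penalty \<gamma>) c"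
  unfolding CR_def CR_on_def competitive_ratio_on_def
proof (intro INF_greatest)
  fix P arr
  assume P: "P \<in> {P. valid_products P \<and> min_init P = c}"
    and arr: "arr \<in> {arr. 1 \<le> length arr \<and> valid_arrivals P arr \<and> True \<and> 0 < OPT P arr}"
  interpret in': input P arr using P arr by unfold_locales auto
  have "c \<le> init P i" if "i \<in> items P" for i
    using P that by (auto simp: min_init_def)
  then interpret bib_exp P arr orc br \<gamma> c
    using assms by unfold_locales (auto intro: exp_penalty_nonneg exp_penalty_0)
  have "OPT P arr \<le> loss * expected_revenue P arr policy / (1 - exp (- 1))"
    using BIB_competitive by (intro in'.OPT_le) (simp add: pos_le_divide_eq mult.commute)
  then have "(1 - exp (- 1)) * OPT P arr \<le> loss * expected_revenue P arr policy"
    by (simp add: pos_le_divide_eq mult.commute)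
  then have "(1 - exp (- 1)) / loss \<le> expected_revenue P arr policy / OPT P arr"
    using loss_ge_1 arr by (simp add: field_simps)
  then show "ereal ((1 - 1 / exp 1) / ((1 + \<gamma> / c) * (1 + 1 / \<gamma>)))
      \<le> ereal (expected_revenue P arr (run (BIB orc br exp_penalty \<gamma>) P arr) / OPT P arr)"
    by (simp add: loss_def exp_minus inverse_eq_divide)
qed


section \<open>Asymptotic optimality\<close>

text \<open>Fewer instances can only raise the infimum. Applied to BIB, this gives (b) and the upper
  half of (a).\<close>

lemma CR_le:
  assumes "online_algorithm A" "1 \<le> c"
  shows "CR A c \<le> ereal (1 - 1 / exp 1)"
proof -
  have "CR A c \<le> CR_on vertex_weighted_b_matching A c"
    unfolding CR_def by (rule CR_on_antimono) simp
  also have "\<dots> \<le> ereal (1 - 1 / exp 1)"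
    using assms by (rule CR_on_matching_le)
  finally show ?thesis .
qed

lemma limsup_leI:
  fixes f :: "nat \<Rightarrow> ereal"
  assumes "\<And>n. 1 \<le> n \<Longrightarrow> f n \<le> a"
  shows "limsup f \<le> a"
  using assms by (intro Limsup_bounded eventually_sequentiallyI)

text \<open>The two limits say that both factors of \<open>loss\<close> tend to 1.\<close>

lemma theta_sqrt_limits:
  fixes \<gamma> :: "nat \<Rightarrow> nat"
  assumes "(\<lambda>n. real (\<gamma> n)) \<in> \<Theta>(\<lambda>n. sqrt (real n))"
  shows "(\<lambda>n. real (\<gamma> n) / real n) \<longlonglongrightarrow> 0" "(\<lambda>n. 1 / real (\<gamma> n)) \<longlonglongrightarrow> 0"
proof -
  from assms have O: "(\<lambda>n. real (\<gamma> n)) \<in> O(\<lambda>n. sqrt (real n))"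
    and \<Omega>: "(\<lambda>n. real (\<gamma> n)) \<in> \<Omega>(\<lambda>n. sqrt (real n))"
    by auto
  have "(\<lambda>n. sqrt (real n)) \<in> o(\<lambda>n. real n)" by real_asymp
  with O have "(\<lambda>n. real (\<gamma> n)) \<in> o(\<lambda>n. real n)"
    by (rule landau_o.big_small_trans)
  then show "(\<lambda>n. real (\<gamma> n) / real n) \<longlonglongrightarrow> 0" by (rule smalloD_tendsto)
  have "(\<lambda>n. 1 :: real) \<in> o(\<lambda>n. sqrt (real n))" by real_asymp
  moreover have "(\<lambda>n. sqrt (real n)) \<in> O(\<lambda>n. real (\<gamma> n))"
    using \<Omega> by (simp add: bigomega_iff_bigo)
  ultimately have "(\<lambda>n. 1 :: real) \<in> o(\<lambda>n. real (\<gamma> n))"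
    by (rule landau_o.small_big_trans)
  then show "(\<lambda>n. 1 / real (\<gamma> n)) \<longlonglongrightarrow> 0" by (rule smalloD_tendsto)
qed

lemma CR_BIB_exp_penalty_tendsto:
  assumes orc: "exact_oracle orc" "valid_batch_rule br"
    and \<gamma>: "\<forall>c\<ge>1. 1 \<le> \<gamma> c \<and> \<gamma> c \<le> c"
    and theta: "(\<lambda>c. real (\<gamma> c)) \<in> \<Theta>(\<lambda>c. sqrt (real c))"
  shows "(\<lambda>c. CR (BIB orc br exp_penalty (\<gamma> c)) c) \<longlonglongrightarrow> ereal (1 - 1 / exp 1)"
proof (rule tendsto_sandwich)
  let ?lower = "\<lambda>c. (1 - 1 / exp 1) / ((1 + real (\<gamma> c) / c) * (1 + 1 / real (\<gamma> c)))"
  show "\<forall>\<^sub>F c in sequentially. ereal (?lower c) \<le> CR (BIB orc br exp_penalty (\<gamma> c)) c"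
    using \<gamma> by (intro eventually_sequentiallyI[of 1] CR_BIB_ge orc) auto
  show "\<forall>\<^sub>F c in sequentially. CR (BIB orc br exp_penalty (\<gamma> c)) c \<le> ereal (1 - 1 / exp 1)"
    using \<gamma> by (intro eventually_sequentiallyI[of 1] CR_le online_algorithm_BIB orc)
      (auto intro: exp_penalty_nonneg exp_penalty_0)
  have "?lower \<longlonglongrightarrow> (1 - 1 / exp 1) / ((1 + 0) * (1 + 0))"
    by (intro tendsto_intros theta_sqrt_limits[OF theta]) auto
  then show "(\<lambda>c. ereal (?lower c)) \<longlonglongrightarrow> ereal (1 - 1 / exp 1)"
    by (simp add: lim_ereal)
qed simp

theorem mainTheorem2:
  shows
    "(\<forall>orc br. \<forall>\<gamma> :: nat \<Rightarrow> nat.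
        exact_oracle orc \<and> valid_batch_rule br \<and>
        (\<forall>c\<^sub>0 \<ge> 1. 1 \<le> \<gamma> c\<^sub>0 \<and> \<gamma> c\<^sub>0 \<le> c\<^sub>0) \<and>
        (\<lambda>c\<^sub>0. real (\<gamma> c\<^sub>0)) \<in> \<Theta>(\<lambda>c\<^sub>0. sqrt (real c\<^sub>0)) \<longrightarrow>
        (\<lambda>c\<^sub>0. CR (BIB orc br exp_penalty (\<gamma> c\<^sub>0)) c\<^sub>0) \<longlonglongrightarrow> ereal (1 - 1 / exp 1)) \<and>
     (\<forall>orc br. \<forall>\<Psi>' :: nat \<Rightarrow> real \<Rightarrow> real. \<forall>\<gamma>' :: nat \<Rightarrow> nat.
        exact_oracle orc \<and> valid_batch_rule br \<and>
        (\<forall>c\<^sub>0 \<ge> 1. admissible_penalty (\<Psi>' c\<^sub>0) \<and> 1 \<le> \<gamma>' c\<^sub>0 \<and> \<gamma>' c\<^sub>0 \<le> c\<^sub>0) \<longrightarrow>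
        limsup (\<lambda>c\<^sub>0. CR (BIB orc br (\<Psi>' c\<^sub>0) (\<gamma>' c\<^sub>0)) c\<^sub>0) \<le> ereal (1 - 1 / exp 1)) \<and>
     (\<forall>A. online_algorithm A \<longrightarrow>
        limsup (CR_on no_shocks A) \<le> ereal (1 - 1 / exp 1) \<and>
        limsup (CR_on vertex_weighted_b_matching A) \<le> ereal (1 - 1 / exp 1))"
proof (intro conjI allI impI)
  fix orc br and \<gamma> :: "nat \<Rightarrow> nat"
  assume "exact_oracle orc \<and> valid_batch_rule br \<and>
        (\<forall>c\<^sub>0 \<ge> 1. 1 \<le> \<gamma> c\<^sub>0 \<and> \<gamma> c\<^sub>0 \<le> c\<^sub>0) \<and>
        (\<lambda>c\<^sub>0. real (\<gamma> c\<^sub>0)) \<in> \<Theta>(\<lambda>c\<^sub>0. sqrt (real c\<^sub>0))"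
  then show "(\<lambda>c\<^sub>0. CR (BIB orc br exp_penalty (\<gamma> c\<^sub>0)) c\<^sub>0) \<longlonglongrightarrow> ereal (1 - 1 / exp 1)"
    by (intro CR_BIB_exp_penalty_tendsto) auto
next
  fix orc br and \<Psi>' :: "nat \<Rightarrow> real \<Rightarrow> real" and \<gamma>' :: "nat \<Rightarrow> nat"
  assume "exact_oracle orc \<and> valid_batch_rule br \<and>
        (\<forall>c\<^sub>0 \<ge> 1. admissible_penalty (\<Psi>' c\<^sub>0) \<and> 1 \<le> \<gamma>' c\<^sub>0 \<and> \<gamma>' c\<^sub>0 \<le> c\<^sub>0)"
  then show "limsup (\<lambda>c\<^sub>0. CR (BIB orc br (\<Psi>' c\<^sub>0) (\<gamma>' c\<^sub>0)) c\<^sub>0) \<le> ereal (1 - 1 / exp 1)"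
    by (intro limsup_leI CR_le online_algorithm_BIB) (auto simp: admissible_penalty_def image_subset_iff)
next
  fix A assume A: "online_algorithm A"
  show "limsup (CR_on vertex_weighted_b_matching A) \<le> ereal (1 - 1 / exp 1)"
    using A by (intro limsup_leI CR_on_matching_le)
  have "CR_on no_shocks A c \<le> CR_on vertex_weighted_b_matching A c" for c
    by (rule CR_on_antimono) (simp add: vertex_weighted_b_matching_def)
  then show "limsup (CR_on no_shocks A) \<le> ereal (1 - 1 / exp 1)"
    using CR_on_matching_le[OF A] by (intro limsup_leI) (blast intro: order_trans)
qed

end
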